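(* Let $X$ be an affine algebraic variety over $k$ of pure dimension $d$, and let $e\in\mathbb{N}$. The map $$\pi_e\colon X_\infty\to\pi_e(X_\infty)\subseteq(k^n)^{e+1}$$ is a piecewise trivial fibration over $\pi_e(\mathcal{A}_e(X))$ with fibre $\mathfrak{m}^{e+1}\cdot\mathcal{A}^d$. This means: $\pi_e(\mathcal{A}_e(X))$ can be covered by finitely many locally (Zariski-) closed subsets $\mathcal{S}$ such that there exist textile invertible maps $$\varphi\colon\pi_e^{-1}(\mathcal{S})\to\mathcal{S}\times(\mathfrak{m}^{e+1}\cdot\mathcal{A}^d)$$ with $\mathrm{proj}_1\circ\varphi=\pi_e$ on $\pi_e^{-1}(\mathcal{S})$, where $\mathrm{proj}_1$ is the projection onto the first factor.
   Context: Let $k$ be a field of characteristic $0$. $\mathcal{A}=k[[t]]$ is the space of arcs, identified with sequences $(a_i)_{i\in\mathbb{N}}$ in $k$ via $\sum a_it^i$ ($\mathbb N\ni 0$), and $\mathfrak{m}=(t)$. Let $X\subseteq\mathbb{A}_k^n$ be given by $f_1,\dots,f_N\in k[x_1,\dots,x_n]$. Its arc space is $X_\infty=\{a=(a^1,\dots,a^n)\in k[[t]]^n: f_1(a)=\dots=f_N(a)=0\}$. The map $\pi_e\colon X_\infty\to(\mathcal{A}/\mathfrak{m}^{e+1})^n\cong(k^n)^{e+1}$ sends an arc to the vector $(a_0,\dots,a_e)$ of its first $e+1$ coefficient vectors. For an ideal $I\subseteq k[x_1,\dots,x_n]$ and an arc $a$, $\mathrm{ord}_I(a)=\min\{\mathrm{ord}_t\,g(a):g\in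 I\}$. Let $I$ be the ideal of $\mathrm{Sing}(X)$, given by $f_1,\dots,f_N$ and all $(n-d)$-minors of the Jacobian matrix $(\partial f_i/\partial x_j)_{ij}$; then $\mathcal{A}_e(X)=\{a\in X_\infty:\mathrm{ord}_I(a)\le e\}$. A map between spaces of vectors of arcs is textile if each coefficient of its output is a polynomial over $k$ in the coefficients of the input; a map on a subset is textile if it is the restriction of a textile map on the whole space. The coordinates of points of $\mathcal{S}\subseteq(k^n)^{e+1}$ are regarded as coefficients as well. A textile map is invertible if it has an inverse which is again textile.
   Formalization: The inverse of φ is textile only once a polynomial h on (k^n)^{e+1} without zeros on S may be inverted: it is polynomial in the coefficients and 1/h(s). With polynomials alone the claim fails, e.g. for uv = w^2 over C and e = 1. *)

theory Defs
  imports
    "HOL-Library.Poly_Mapping"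
    "HOL-Library.Cardinality"
    "HOL-Library.Extended_Nat"
    "HOL-Computational_Algebra.Formal_Power_Series"
    "Jordan_Normal_Form.Determinant"
begin

section \<open>Polynomials in the variables indexed by a type\<close>

type_synonym ('x, 'a) mpoly = "('x \<Rightarrow>\<^sub>0 nat) \<Rightarrow>\<^sub>0 'a"

text \<open>The coefficients are sent to the target ring by \<open>c\<close>, the variables by \<open>x\<close>.\<close>

definition mpoly_eval ::
  "('a \<Rightarrow> 'b) \<Rightarrow> ('x \<Rightarrow> 'b) \<Rightarrow> ('x, 'a::zero) mpoly \<Rightarrow> 'b::comm_ring_1" where
  "mpoly_eval c x p =
     (\<Sum>m\<in>Poly_Mapping.keys p.
        c (Poly_Mapping.lookup p m) *
        (\<Prod>v\<in>Poly_Mapping.keys m. x v ^ Poly_Mapping.lookup m v))"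

definition mpoly_pderiv :: "'x \<Rightarrow> ('x, 'a::comm_ring_1) mpoly \<Rightarrow> ('x, 'a) mpoly" where
  "mpoly_pderiv v p =
     (\<Sum>m\<in>Poly_Mapping.keys p.
        Poly_Mapping.single (m - Poly_Mapping.single v 1)
          (of_nat (Poly_Mapping.lookup m v) * Poly_Mapping.lookup p m))"

section \<open>Ideals and dimension\<close>

definition is_ideal :: "'r::comm_ring_1 set \<Rightarrow> bool" where
  "is_ideal = module.subspace (*)"

definition ideal_gen :: "'r::comm_ring_1 set \<Rightarrow> 'r set" where
  "ideal_gen = module.span (*)"

definition is_prime_ideal :: "'r::comm_ring_1 set \<Rightarrow> bool" where
  "is_prime_ideal P \<longleftrightarrow>
     is_ideal P \<and> 1 \<notin> P \<and> (\<forall>a b. a * b \<in> P \<longrightarrow> a \<in> P \<or> b \<in> P)"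

definition is_minimal_prime :: "'r::comm_ring_1 set \<Rightarrow> 'r set \<Rightarrow> bool" where
  "is_minimal_prime J P \<longleftrightarrow>
     is_prime_ideal P \<and> J \<subseteq> P \<and> (\<forall>Q. is_prime_ideal Q \<and> J \<subseteq> Q \<and> Q \<subseteq> P \<longrightarrow> Q = P)"

text \<open>The Krull dimension of the quotient by a (proper) ideal \<open>J\<close>: the primes of the quotient are
  the primes containing \<open>J\<close>, and a chain of \<open>l + 1\<close> of them has length \<open>l\<close>.\<close>

definition quotient_dim :: "'r::comm_ring_1 set \<Rightarrow> enat" where
  "quotient_dim J =
     (SUP l\<in>{l. \<exists>Q. (\<forall>i\<le>l. is_prime_ideal (Q i) \<and> J \<subseteq> Q i) \<and> (\<forall>i<l. Q i \<subset> Q (Suc i))}. enat l)"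

text \<open>Irreducible components of the zero set of \<open>J\<close>, over a field that need not be algebraically
  closed, are the minimal primes of \<open>J\<close>.\<close>

definition pure_dim :: "'r::comm_ring_1 set \<Rightarrow> nat \<Rightarrow> bool" where
  "pure_dim J d \<longleftrightarrow> (\<forall>P. is_minimal_prime J P \<longrightarrow> quotient_dim P = enat d)"

text \<open>For \<open>m = n - d\<close>, the ideal of the singular locus of a variety of pure dimension \<open>d\<close> in
  \<open>n\<close>-space. A minor is given by injective listings of its rows and of its columns; another
  order of listing only changes the sign.\<close>

definition minors_of_jacobian ::
  "nat \<Rightarrow> nat \<Rightarrow> (nat \<Rightarrow> ('n, 'a::comm_ring_1) mpoly) \<Rightarrow> ('n, 'a) mpoly set" where
  "minors_of_jacobian m N f =
     {det (mat m m (\<lambda>(i, j). mpoly_pderiv (c j) (f (r i)))) | r c.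
        inj_on r {..<m} \<and> r ` {..<m} \<subseteq> {..<N} \<and> inj_on c {..<m}}"

definition sing_ideal ::
  "nat \<Rightarrow> nat \<Rightarrow> (nat \<Rightarrow> ('n::finite, 'a::comm_ring_1) mpoly) \<Rightarrow> ('n, 'a) mpoly set" where
  "sing_ideal d N f = ideal_gen (f ` {..<N} \<union> minors_of_jacobian (CARD('n) - d) N f)"

section \<open>Arcs\<close>

definition arc_eval :: "('n \<Rightarrow> 'a::comm_ring_1 fps) \<Rightarrow> ('n, 'a) mpoly \<Rightarrow> 'a fps" where
  "arc_eval = mpoly_eval fps_const"

definition arc_space ::
  "nat \<Rightarrow> (nat \<Rightarrow> ('n, 'a::comm_ring_1) mpoly) \<Rightarrow> ('n \<Rightarrow> 'a fps) set" where
  "arc_space N f = {a. \<forall>i<N. arc_eval a (f i) = 0}"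

definition fps_order :: "'a::zero fps \<Rightarrow> enat" where
  "fps_order g = (if g = 0 then \<infinity> else enat (subdegree g))"

definition order_along ::
  "('n, 'a::comm_ring_1) mpoly set \<Rightarrow> ('n \<Rightarrow> 'a fps) \<Rightarrow> enat" where
  "order_along I a = (INF g\<in>I. fps_order (arc_eval a g))"

definition arcs_order_le ::
  "nat \<Rightarrow> nat \<Rightarrow> (nat \<Rightarrow> ('n::finite, 'a::comm_ring_1) mpoly) \<Rightarrow> nat \<Rightarrow> ('n \<Rightarrow> 'a fps) set" where
  "arcs_order_le d N f e = {a \<in> arc_space N f. order_along (sing_ideal d N f) a \<le> enat e}"

text \<open>A vector of \<open>e + 1\<close> coefficient vectors is a function vanishing at all \<open>(i, v)\<close> with
  \<open>i > e\<close>.\<close>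

definition jet_space :: "nat \<Rightarrow> (nat \<times> 'n \<Rightarrow> 'a::zero) set" where
  "jet_space e = {s. \<forall>i v. e < i \<longrightarrow> s (i, v) = 0}"

definition arc_coeffs :: "('i \<Rightarrow> 'a::zero fps) \<Rightarrow> nat \<times> 'i \<Rightarrow> 'a" where
  "arc_coeffs a = (\<lambda>(i, v). fps_nth (a v) i)"

definition jet_map :: "nat \<Rightarrow> ('n \<Rightarrow> 'a::zero fps) \<Rightarrow> nat \<times> 'n \<Rightarrow> 'a" where
  "jet_map e a = (\<lambda>(i, v). if i \<le> e then arc_coeffs a (i, v) else 0)"

definition zariski_closed :: "nat \<Rightarrow> (nat \<times> 'n \<Rightarrow> 'a::comm_ring_1) set \<Rightarrow> bool" where
  "zariski_closed e Z \<longleftrightarrow> (\<exists>G. Z = {s \<in> jet_space e. \<forall>g\<in>G. mpoly_eval id s g = 0})"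

definition zariski_locally_closed :: "nat \<Rightarrow> (nat \<times> 'n \<Rightarrow> 'a::comm_ring_1) set \<Rightarrow> bool" where
  "zariski_locally_closed e S \<longleftrightarrow>
     (\<exists>Z Z'. zariski_closed e Z \<and> zariski_closed e Z' \<and> S = Z - Z')"

text \<open>Vectors of \<open>d\<close> arcs of order at least \<open>e + 1\<close>, as functions that vanish from \<open>d\<close> on.\<close>

definition fibre_space :: "nat \<Rightarrow> nat \<Rightarrow> (nat \<Rightarrow> 'a::comm_ring_1 fps) set" where
  "fibre_space e d = {b. (\<forall>j<d. fps_X ^ (e + 1) dvd b j) \<and> (\<forall>j\<ge>d. b j = 0)}"

section \<open>Textile maps\<close>

text \<open>The points of source and target are read through their families of coefficients \<open>cs\<close> and
  \<open>ct\<close>. The polynomials \<open>T y\<close> define a textile map on the whole space, and \<open>F\<close> is its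
  restriction to \<open>D\<close>.\<close>

definition textile_on ::
  "('p \<Rightarrow> 'x \<Rightarrow> 'a::comm_ring_1) \<Rightarrow> ('q \<Rightarrow> 'y \<Rightarrow> 'a) \<Rightarrow> 'p set \<Rightarrow> ('p \<Rightarrow> 'q) \<Rightarrow> bool" where
  "textile_on cs ct D F \<longleftrightarrow>
     (\<exists>T :: 'y \<Rightarrow> ('x, 'a) mpoly. \<forall>p\<in>D. \<forall>y. ct (F p) y = mpoly_eval id (cs p) (T y))"

definition product_coeffs ::
  "(nat \<times> 'n \<Rightarrow> 'a::zero) \<times> (nat \<Rightarrow> 'a fps) \<Rightarrow> (nat \<times> 'n) + (nat \<times> nat) \<Rightarrow> 'a" where
  "product_coeffs = (\<lambda>(s, b). case_sum s (arc_coeffs b))"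

text \<open>The coordinates of a point \<open>s\<close> of the affine variety \<open>{h \<noteq> 0}\<close> are those of \<open>s\<close>, together
  with \<open>1 / h s\<close> (index \<open>None\<close>).\<close>

definition localized_coeffs ::
  "(nat \<times> 'n, 'a::field) mpoly \<Rightarrow>
   (nat \<times> 'n \<Rightarrow> 'a) \<times> (nat \<Rightarrow> 'a fps) \<Rightarrow> (nat \<times> 'n) option + (nat \<times> nat) \<Rightarrow> 'a" where
  "localized_coeffs h =
     (\<lambda>(s, b). case_sum (case_option (inverse (mpoly_eval id s h)) s) (arc_coeffs b))"

text \<open>\<open>\<phi>\<close> is textile in the strict sense. Its inverse is textile in the coordinates that \<open>S\<close> has
  as a locally closed subvariety of some \<open>{h \<noteq> 0}\<close>: it is polynomial in the coefficients and in
  \<open>1 / h\<close>, for one polynomial \<open>h\<close> without zeros on \<open>S\<close>. If only \<open>h = 1\<close> were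
  admitted, the trivializations would not always exist: let \<open>X\<close> be the cone
  \<open>u v = w^2\<close> over the complex numbers and \<open>e = 1\<close>. Some \<open>S\<close> meets the 1-jets \<open>(0, p)\<close>, \<open>p \<noteq> 0\<close>
  in the cone, in a dense subset. A pair of mutually inverse polynomial maps
  over it extends to the Zariski closures, hence over \<open>p = 0\<close>, where it identifies \<open>X\<^sub>\<infinity>\<close> with an
  infinite-dimensional affine space. But \<open>u\<^sub>0 v\<^sub>0 = w\<^sub>0^2\<close> shows that the ring of polynomial
  functions on \<open>X\<^sub>\<infinity>\<close> is not factorial.\<close>

definition textile_invertible ::
  "nat \<Rightarrow> nat \<Rightarrow> ('n \<Rightarrow> 'a::field fps) set \<Rightarrow> (nat \<times> 'n \<Rightarrow> 'a) set \<Rightarrow>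
   (('n \<Rightarrow> 'a fps) \<Rightarrow> (nat \<times> 'n \<Rightarrow> 'a) \<times> (nat \<Rightarrow> 'a fps)) \<Rightarrow> bool" where
  "textile_invertible e d D S \<phi> \<longleftrightarrow>
     bij_betw \<phi> D (S \<times> fibre_space e d) \<and>
     textile_on arc_coeffs product_coeffs D \<phi> \<and>
     (\<exists>h. (\<forall>s\<in>S. mpoly_eval id s h \<noteq> 0) \<and>
          textile_on (localized_coeffs h) arc_coeffs (S \<times> fibre_space e d) (inv_into D \<phi>))"

end

theory Submission
  imports Defs
begin

text \<open>
  Let \<open>a\<close> be an arc of order at most \<open>e\<close> along the singular locus, and choose an
  \<open>m\<close>-minor \<open>G\<close> of the Jacobian matrix, \<open>m = n - d\<close>, whose order \<open>e' \<le> e\<close> along \<open>a\<close> is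
  minimal; let \<open>F\<close> be the equations of its rows and \<open>C\<close> the variables of its columns. Multiplied
  by the adjugate matrix, the system \<open>F = 0\<close> becomes solvable by a Newton iteration: by Cramer's
  rule all coefficients of its linear part are minors and hence divisible by \<open>t^e'\<close>. So the arcs
  with \<open>F = 0\<close> over a fixed \<open>e\<close>-jet correspond to their coordinates outside \<open>C\<close>, which vary
  freely in \<open>(t^(e+1))\<close>, and the solution depends polynomially on these, on the jet and on
  the inverse of the leading coefficient of \<open>G\<close>.

  It remains to see that such an arc lies in \<open>X\<close> if some other arc over the same jet does. The
  line joining the two has a generic point whose prime ideal \<open>P\<close> contains \<open>F\<close> and is contained in
  the prime \<open>Q\<close> of an arc in \<open>X\<close> with \<open>G \<notin> Q\<close>. The largest ideals in \<open>P\<close> and in \<open>Q\<close> stable under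
  all derivations that annihilate \<open>F\<close> are prime of transcendence degree \<open>d\<close>, by the Jacobian
  criterion, and so is a minimal prime of \<open>X\<close> below \<open>Q\<close>. Hence the three are equal, and the
  equations of \<open>X\<close> belong to \<open>P\<close>.
\<close>

section \<open>Polynomials\<close>

text \<open>The vanishing ideals of two arcs over the same jet are in general not comparable, so no
  equation can be transported directly from one to the other. The polynomials that vanish on the
  whole line through them form a prime contained in both; it is the intermediary. Dimension enters
  through two inequalities: a strict inclusion of primes raises the number of independent elements
  by one, and a prime containing \<open>F\<close> but not \<open>G\<close> admits at most
  \<open>CARD('n) - m = d\<close> of them. So nested primes of this kind coincide as soon as the
  larger one admits \<open>d\<close> independent elements. The bound \<open>e' \<le> e\<close>
  shapes the rest. It makes the coefficients of the minors up to order \<open>e'\<close> visible in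
  the \<open>e\<close>-jet, so that the strata are sets of jets. It also makes terms of second order
  harmless: if two corrections in \<open>(t^(e+1))\<close> agree modulo \<open>t^k\<close>, the
  nonlinear error has order at least \<open>e + 1 + k\<close>, which after division by
  \<open>t^e'\<close> is still at least \<open>k + 1\<close>.\<close>

abbreviation Const :: "'a::zero \<Rightarrow> ('x, 'a) mpoly" where
  "Const \<equiv> Poly_Mapping.single 0"

definition mvar :: "'x \<Rightarrow> ('x, 'a::zero_neq_one) mpoly" where
  "mvar v = Poly_Mapping.single (Poly_Mapping.single v 1) 1"

lemma poly_mapping_sum_singles:
  "p = (\<Sum>m\<in>Poly_Mapping.keys p. Poly_Mapping.single m (Poly_Mapping.lookup p m))"
  by (rule poly_mapping_eqI)
    (auto simp: lookup_sum lookup_single when_def sum.delta in_keys_iff)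

lemma mpoly_induct [case_names const var add mult]:
  fixes p :: "('x, 'a::comm_ring_1) mpoly"
  assumes const: "\<And>a. P (Const a)" and var: "\<And>v. P (mvar v)"
    and add: "\<And>p q. P p \<Longrightarrow> P q \<Longrightarrow> P (p + q)"
    and mult: "\<And>p q. P p \<Longrightarrow> P q \<Longrightarrow> P (p * q)"
  shows "P p"
proof -
  have 0: "P 0" using const[of 0] by simp
  have 1: "P 1" using const[of 1] by simp
  have pow: "P (Poly_Mapping.single (Poly_Mapping.single v k) 1)" for v k
  proof (induction k)
    case (Suc k)
    have "Poly_Mapping.single (Poly_Mapping.single v (Suc k)) (1::'a) =
        mvar v * Poly_Mapping.single (Poly_Mapping.single v k) 1"
      by (simp add: mvar_def mult_single flip: single_add)
    then show ?case using mult[OF var Suc] by simp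
  qed (use 1 in simp)
  have mon: "P (Poly_Mapping.single (\<Sum>v\<in>A. Poly_Mapping.single v (k v)) 1)" if "finite A" for A k
    using that
  proof induction
    case (insert v A)
    have "Poly_Mapping.single (\<Sum>v\<in>insert v A. Poly_Mapping.single v (k v)) (1::'a) =
        Poly_Mapping.single (Poly_Mapping.single v (k v)) 1 *
        Poly_Mapping.single (\<Sum>v\<in>A. Poly_Mapping.single v (k v)) 1"
      using insert by (simp add: mult_single)
    then show ?case using mult[OF pow insert.IH] by simp
  qed (use 1 in simp)
  have sing: "P (Poly_Mapping.single m a)" for m a
  proof -
    have "P (Const a * Poly_Mapping.single m 1)"
      using mult[OF const mon[OF finite_keys]] poly_mapping_sum_singles[of m] by metis
    then show ?thesis by (simp add: mult_single)
  qed
  have "P (\<Sum>m\<in>A. Poly_Mapping.single m (Poly_Mapping.lookup p m))" if "finite A" for A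
    using that by induction (auto simp: 0 intro: add sing)
  then show ?thesis using poly_mapping_sum_singles[of p] finite_keys by metis
qed

subsection \<open>Evaluation\<close>

definition monom_eval :: "('x \<Rightarrow> 'b) \<Rightarrow> ('x \<Rightarrow>\<^sub>0 nat) \<Rightarrow> 'b::comm_ring_1" where
  "monom_eval x m = (\<Prod>v\<in>Poly_Mapping.keys m. x v ^ Poly_Mapping.lookup m v)"

lemma monom_eval_superset:
  assumes "finite V" "Poly_Mapping.keys m \<subseteq> V"
  shows "monom_eval x m = (\<Prod>v\<in>V. x v ^ Poly_Mapping.lookup m v)"
  unfolding monom_eval_def using assms
  by (intro prod.mono_neutral_left) (auto simp: in_keys_iff)

lemma monom_eval_add: "monom_eval x (m + m') = monom_eval x m * monom_eval x m'"
proof -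
  let ?V = "Poly_Mapping.keys m \<union> Poly_Mapping.keys m'"
  have "monom_eval x (m + m') = (\<Prod>v\<in>?V. x v ^ Poly_Mapping.lookup (m + m') v)"
    by (rule monom_eval_superset) (auto simp: keys_add)
  also have "\<dots> = monom_eval x m * monom_eval x m'"
    by (subst (1 2) monom_eval_superset[of ?V]) (auto simp: lookup_add power_add prod.distrib)
  finally show ?thesis .
qed

lemma monom_eval_zero [simp]: "monom_eval x 0 = 1"
  by (simp add: monom_eval_def)

lemma monom_eval_single [simp]: "monom_eval x (Poly_Mapping.single v k) = x v ^ k"
  by (simp add: monom_eval_def)

lemma mpoly_eval_superset:
  assumes "c 0 = 0" "finite M" "Poly_Mapping.keys p \<subseteq> M"
  shows "mpoly_eval c x p = (\<Sum>m\<in>M. c (Poly_Mapping.lookup p m) * monom_eval x m)"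
  unfolding mpoly_eval_def monom_eval_def using assms
  by (intro sum.mono_neutral_left) (auto simp: in_keys_iff)

lemma comm_ring_hom_mpoly_eval:
  fixes c :: "'a::comm_ring_1 \<Rightarrow> 'b::comm_ring_1"
  assumes "comm_ring_hom c"
  shows "comm_ring_hom (mpoly_eval c x)"
    and "mpoly_eval c x (Poly_Mapping.single m a) = c a * monom_eval x m"
proof -
  interpret c: comm_ring_hom c by fact
  have single: "mpoly_eval c x (Poly_Mapping.single m a) = c a * monom_eval x m" for m a
    by (subst mpoly_eval_superset[of _ "{m}"]) auto
  then show "mpoly_eval c x (Poly_Mapping.single m a) = c a * monom_eval x m" .
  have add: "mpoly_eval c x (p + q) = mpoly_eval c x p + mpoly_eval c x q" for p q
  proof -
    let ?M = "Poly_Mapping.keys p \<union> Poly_Mapping.keys q"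
    have "mpoly_eval c x (p + q) = (\<Sum>m\<in>?M. c (Poly_Mapping.lookup (p + q) m) * monom_eval x m)"
      by (rule mpoly_eval_superset) (auto simp: keys_add)
    also have "\<dots> = mpoly_eval c x p + mpoly_eval c x q"
      by (subst (1 2) mpoly_eval_superset[of _ ?M])
        (auto simp: lookup_add c.hom_add distrib_right sum.distrib)
    finally show ?thesis .
  qed
  have zero: "mpoly_eval c x 0 = 0" by (simp add: mpoly_eval_def)
  have sum: "mpoly_eval c x (sum g A) = (\<Sum>i\<in>A. mpoly_eval c x (g i))"
    for g :: "('c \<Rightarrow>\<^sub>0 nat) \<Rightarrow> _" and A
    by (induction A rule: infinite_finite_induct) (auto simp: add zero)
  have exp: "mpoly_eval c x q =
      (\<Sum>k\<in>Poly_Mapping.keys q. mpoly_eval c x (Poly_Mapping.single k (Poly_Mapping.lookup q k)))" for q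
    using arg_cong[OF poly_mapping_sum_singles[of q], of "mpoly_eval c x"] by (simp add: sum)
  have mult1: "mpoly_eval c x (Poly_Mapping.single m a * q) = c a * monom_eval x m * mpoly_eval c x q"
    for m a q
  proof -
    have "mpoly_eval c x (Poly_Mapping.single m a * q) = mpoly_eval c x
       (\<Sum>k\<in>Poly_Mapping.keys q. Poly_Mapping.single m a * Poly_Mapping.single k (Poly_Mapping.lookup q k))"
      by (subst poly_mapping_sum_singles[of q]) (simp add: sum_distrib_left)
    also have "\<dots> = (\<Sum>k\<in>Poly_Mapping.keys q.
        c a * monom_eval x m * mpoly_eval c x (Poly_Mapping.single k (Poly_Mapping.lookup q k)))"
      by (simp add: sum mult_single single c.hom_mult monom_eval_add mult_ac)
    also have "\<dots> = c a * monom_eval x m * mpoly_eval c x q"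
      by (simp add: exp[of q] sum_distrib_left)
    finally show ?thesis .
  qed
  have mult: "mpoly_eval c x (p * q) = mpoly_eval c x p * mpoly_eval c x q" for p q
  proof -
    have "mpoly_eval c x (p * q) = mpoly_eval c x
       (\<Sum>k\<in>Poly_Mapping.keys p. Poly_Mapping.single k (Poly_Mapping.lookup p k) * q)"
      by (subst poly_mapping_sum_singles[of p]) (simp add: sum_distrib_right)
    also have "\<dots> = (\<Sum>k\<in>Poly_Mapping.keys p.
        mpoly_eval c x (Poly_Mapping.single k (Poly_Mapping.lookup p k)) * mpoly_eval c x q)"
      by (simp add: sum mult1 single)
    also have "\<dots> = mpoly_eval c x p * mpoly_eval c x q"
      by (simp add: exp[of p] sum_distrib_right)
    finally show ?thesis .
  qed
  have one: "mpoly_eval c x 1 = 1"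
    using single[of 0 1] by (simp add: c.hom_one)
  show "comm_ring_hom (mpoly_eval c x)"
    by unfold_locales (auto simp: add zero mult one)
qed

lemma comm_ring_hom_Const: "comm_ring_hom (Const :: 'a::comm_ring_1 \<Rightarrow> ('x, 'a) mpoly)"
  by unfold_locales (auto simp: single_add mult_single)

lemma comm_ring_hom_fps_const: "comm_ring_hom (fps_const :: 'a::comm_ring_1 \<Rightarrow> 'a fps)"
  by unfold_locales auto

lemma comm_ring_hom_id: "comm_ring_hom (id :: 'a::comm_ring_1 \<Rightarrow> 'a)"
  by unfold_locales auto

interpretation arc: comm_ring_hom "arc_eval a" for a
  unfolding arc_eval_def by (rule comm_ring_hom_mpoly_eval[OF comm_ring_hom_fps_const])

interpretation point: comm_ring_hom "mpoly_eval id x" for x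
  by (rule comm_ring_hom_mpoly_eval[OF comm_ring_hom_id])

definition mpoly_subst :: "('y \<Rightarrow> ('x, 'a) mpoly) \<Rightarrow> ('y, 'a::comm_ring_1) mpoly \<Rightarrow> ('x, 'a) mpoly" where
  "mpoly_subst = mpoly_eval Const"

interpretation subst: comm_ring_hom "mpoly_subst u" for u
  unfolding mpoly_subst_def by (rule comm_ring_hom_mpoly_eval[OF comm_ring_hom_Const])

lemma arc_eval_simps [simp]:
  "arc_eval a (Const r) = fps_const r" "arc_eval a (mvar v) = a v"
  by (simp_all add: arc_eval_def mvar_def comm_ring_hom_mpoly_eval(2)[OF comm_ring_hom_fps_const])

lemma point_eval_simps [simp]:
  "mpoly_eval id s (Const r) = r" "mpoly_eval id s (mvar v) = s v"
  by (simp_all add: mvar_def comm_ring_hom_mpoly_eval(2)[OF comm_ring_hom_id])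

lemma mpoly_subst_single:
  "mpoly_subst u (Poly_Mapping.single m r) = Const r * monom_eval u m"
  by (simp add: mpoly_subst_def comm_ring_hom_mpoly_eval(2)[OF comm_ring_hom_Const])

lemma mpoly_subst_simps [simp]:
  "mpoly_subst u (Const r) = Const r" "mpoly_subst u (mvar v) = u v"
  by (simp_all add: mpoly_subst_single mvar_def)

subsection \<open>Derivations\<close>

definition derivation :: "('r::comm_ring_1 \<Rightarrow> 'r) \<Rightarrow> bool" where
  "derivation D \<longleftrightarrow> (\<forall>x y. D (x + y) = D x + D y \<and> D (x * y) = x * D y + D x * y)"

lemma derivation_add: "derivation D \<Longrightarrow> D (x + y) = D x + D y"
  and derivation_mult: "derivation D \<Longrightarrow> D (x * y) = x * D y + D x * y"
  by (auto simp: derivation_def)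

lemma derivation_zero: "derivation D \<Longrightarrow> D 0 = 0"
  using derivation_add[of D 0 0] by simp

lemma derivation_combination:
  assumes "\<And>i. i \<in> I \<Longrightarrow> derivation (D i)"
  shows "derivation (\<lambda>x. \<Sum>i\<in>I. w i * D i x)"
  unfolding derivation_def using assms
  by (auto simp: derivation_add derivation_mult algebra_simps sum_distrib_left sum_distrib_right
      sum.distrib)

lemma derivation_diff:
  assumes "derivation D" "derivation E"
  shows "derivation (\<lambda>x. D x - E x)"
  using assms unfolding derivation_def by (auto simp: algebra_simps)

lemma derivation_scale: "derivation D \<Longrightarrow> derivation (\<lambda>x. r * D x)"
  unfolding derivation_def by (auto simp: algebra_simps)

lemma mpoly_pderiv_superset:
  assumes "finite M" "Poly_Mapping.keys p \<subseteq> M"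
  shows "mpoly_pderiv v p = (\<Sum>m\<in>M. Poly_Mapping.single (m - Poly_Mapping.single v 1)
          (of_nat (Poly_Mapping.lookup m v) * Poly_Mapping.lookup p m))"
  unfolding mpoly_pderiv_def using assms
  by (intro sum.mono_neutral_left) (auto simp: in_keys_iff)

lemma mpoly_pderiv_add: "mpoly_pderiv v (p + q) = mpoly_pderiv v p + mpoly_pderiv v q"
proof -
  let ?M = "Poly_Mapping.keys p \<union> Poly_Mapping.keys q"
  have "mpoly_pderiv v (p + q) = (\<Sum>m\<in>?M. Poly_Mapping.single (m - Poly_Mapping.single v 1)
          (of_nat (Poly_Mapping.lookup m v) * Poly_Mapping.lookup (p + q) m))"
    by (rule mpoly_pderiv_superset) (auto simp: keys_add)
  also have "\<dots> = mpoly_pderiv v p + mpoly_pderiv v q"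
    by (subst (1 2) mpoly_pderiv_superset[of ?M])
      (auto simp: lookup_add distrib_left single_add sum.distrib)
  finally show ?thesis .
qed

lemma mpoly_pderiv_single:
  "mpoly_pderiv v (Poly_Mapping.single m a) =
     Poly_Mapping.single (m - Poly_Mapping.single v 1) (of_nat (Poly_Mapping.lookup m v) * a)"
  by (subst mpoly_pderiv_superset[of "{m}"]) auto

lemma monomial_diff_add:
  fixes m k :: "'x \<Rightarrow>\<^sub>0 nat"
  assumes "Poly_Mapping.lookup m v > 0"
  shows "m - Poly_Mapping.single v (Suc 0) + k = m + k - Poly_Mapping.single v (Suc 0)"
    and "k + (m - Poly_Mapping.single v (Suc 0)) = k + m - Poly_Mapping.single v (Suc 0)"
  using assms by (auto intro!: poly_mapping_eqI simp: lookup_add lookup_minus lookup_single when_def)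

lemma mpoly_pderiv_mult_single:
  fixes m m' :: "'x \<Rightarrow>\<^sub>0 nat" and a b :: "'a::comm_ring_1"
  shows "mpoly_pderiv v (Poly_Mapping.single m a * Poly_Mapping.single m' b) =
    Poly_Mapping.single m a * mpoly_pderiv v (Poly_Mapping.single m' b) +
    mpoly_pderiv v (Poly_Mapping.single m a) * Poly_Mapping.single m' b"
proof -
  have l: "Poly_Mapping.single m a * mpoly_pderiv v (Poly_Mapping.single m' b) =
    Poly_Mapping.single (m + m' - Poly_Mapping.single v 1) (of_nat (Poly_Mapping.lookup m' v) * (a * b))"
    by (cases "Poly_Mapping.lookup m' v = 0")
      (auto simp: mpoly_pderiv_single mult_single monomial_diff_add mult_ac)
  have r: "mpoly_pderiv v (Poly_Mapping.single m a) * Poly_Mapping.single m' b =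
    Poly_Mapping.single (m + m' - Poly_Mapping.single v 1) (of_nat (Poly_Mapping.lookup m v) * (a * b))"
    by (cases "Poly_Mapping.lookup m v = 0")
      (auto simp: mpoly_pderiv_single mult_single monomial_diff_add ac_simps)
  show ?thesis unfolding l r
    by (simp add: mult_single mpoly_pderiv_single lookup_add distrib_right flip: single_add)
      (simp add: add.commute)
qed

lemma derivation_mpoly_pderiv:
  "derivation (mpoly_pderiv v :: ('b, 'a::comm_ring_1) mpoly \<Rightarrow> ('b, 'a) mpoly)"
proof -
  let ?s = "Poly_Mapping.single" let ?k = "Poly_Mapping.keys" let ?l = "Poly_Mapping.lookup"
  have zero: "mpoly_pderiv v 0 = (0 :: ('b, 'a) mpoly)" by (simp add: mpoly_pderiv_def)
  have *: "mpoly_pderiv v (p * q) = p * mpoly_pderiv v q + mpoly_pderiv v p * q"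
    if "finite A" "finite B" "p = (\<Sum>m\<in>A. ?s m (c m))" "q = (\<Sum>m\<in>B. ?s m (c' m))"
    for p q :: "('b, 'a) mpoly" and A B c c'
  proof -
    have 1: "mpoly_pderiv v (?s m a * q) = ?s m a * mpoly_pderiv v q + mpoly_pderiv v (?s m a) * q"
      for m a using that(2) unfolding that(4)
      by induction (auto simp: zero mpoly_pderiv_add algebra_simps mpoly_pderiv_mult_single)
    show ?thesis using that(1) unfolding that(3)
      by induction (auto simp: zero mpoly_pderiv_add distrib_left distrib_right 1)
  qed
  have "mpoly_pderiv v (p * q) = p * mpoly_pderiv v q + mpoly_pderiv v p * q"
    for p q :: "('b, 'a) mpoly"
    by (rule *[of "?k p" "?k q"]) (use poly_mapping_sum_singles in auto)
  then show ?thesis by (simp add: derivation_def mpoly_pderiv_add)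
qed

lemma mpoly_pderiv_simps [simp]:
  "mpoly_pderiv v (Const a) = 0"
  "mpoly_pderiv v (mvar w) = (if v = w then 1 else 0)"
  by (auto simp: mpoly_pderiv_single mvar_def lookup_single when_def)

lemma derivation_mpoly_subst:
  assumes D: "derivation D" "\<And>a. D (Const a) = 0"
    and V: "finite V" "\<And>v. v \<notin> V \<Longrightarrow> D (u v) = 0"
  shows "D (mpoly_subst u p) = (\<Sum>v\<in>V. mpoly_subst u (mpoly_pderiv v p) * D (u v))"
proof (induction p rule: mpoly_induct)
  case (const a)
  show ?case by (simp add: D)
next
  case (var w)
  have "(\<Sum>v\<in>V. mpoly_subst u (mpoly_pderiv v (mvar w)) * D (u v)) = (\<Sum>v\<in>V. if v = w then D (u v) else 0)"
    by (intro sum.cong) auto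
  then show ?case using V by (auto simp: sum.delta)
next
  case (add p q)
  then show ?case by (simp add: derivation_add[OF D(1)] subst.hom_add mpoly_pderiv_add
        distrib_right sum.distrib)
next
  case (mult p q)
  then show ?case
    by (simp add: derivation_mult[OF D(1)] derivation_mult[OF derivation_mpoly_pderiv] subst.hom_add
        subst.hom_mult distrib_right distrib_left sum.distrib sum_distrib_left sum_distrib_right mult_ac)
qed

subsection \<open>Taylor expansion\<close>

lemma arc_eval_cong_dvd:
  assumes "\<And>v. q dvd a v - b v"
  shows "q dvd arc_eval a h - arc_eval b h"
proof (induction h rule: mpoly_induct)
  case (add f g)
  then show ?case using dvd_add[OF add] by (simp add: arc.hom_add algebra_simps)
next
  case (mult f g)
  have "arc_eval a (f * g) - arc_eval b (f * g) =
     arc_eval a f * (arc_eval a g - arc_eval b g) + (arc_eval a f - arc_eval b f) * arc_eval b g"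
    by (simp add: arc.hom_mult algebra_simps)
  then show ?case using mult by simp
qed (use assms in auto)

text \<open>Two moduli are kept apart because a Newton step compares two small corrections
  (\<open>p\<close>) whose mutual distance (\<open>q\<close>) is measured separately. In a product,
  each error term contains an error of a factor, or a deviation from \<open>a\<close>, divisible by
  \<open>p\<close>, times a linear part, divisible by \<open>q\<close>.\<close>

lemma arc_eval_taylor:
  fixes a y z :: "'n::finite \<Rightarrow> 'a::comm_ring_1 fps"
  assumes "\<And>v. p dvd y v" "\<And>v. p dvd z v" "\<And>v. q dvd y v - z v"
  shows "p * q dvd arc_eval (\<lambda>v. a v + y v) h - arc_eval (\<lambda>v. a v + z v) h
            - (\<Sum>v\<in>UNIV. arc_eval a (mpoly_pderiv v h) * (y v - z v))"
proof (induction h rule: mpoly_induct)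
  case (var w)
  have "(\<Sum>v\<in>UNIV. arc_eval a (mpoly_pderiv v (mvar w)) * (y v - z v)) =
      (\<Sum>v\<in>UNIV. if v = w then y v - z v else 0)"
    by (intro sum.cong) auto
  then show ?case by (simp add: sum.delta)
next
  case (add f g)
  let ?d = "\<lambda>h. \<Sum>v\<in>UNIV. arc_eval a (mpoly_pderiv v h) * (y v - z v)"
  have "?d (f + g) = ?d f + ?d g"
    by (simp add: arc.hom_add mpoly_pderiv_add distrib_right sum.distrib)
  then show ?case using dvd_add[OF add] by (simp add: arc.hom_add algebra_simps del: sum_subtractf)
next
  case (mult f g)
  let ?y = "arc_eval (\<lambda>v. a v + y v)" let ?z = "arc_eval (\<lambda>v. a v + z v)" let ?a = "arc_eval a"
  let ?d = "\<lambda>h. \<Sum>v\<in>UNIV. ?a (mpoly_pderiv v h) * (y v - z v)"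
  have q: "q dvd ?d h" for h
    using assms(3) by (intro dvd_sum dvd_mult)
  have fp: "p dvd ?y f - ?a f" by (rule arc_eval_cong_dvd) (use assms in simp)
  have gp: "p dvd ?z g - ?a g" by (rule arc_eval_cong_dvd) (use assms in simp)
  have d: "?d (f * g) = ?a f * ?d g + ?d f * ?a g"
    unfolding sum_distrib_left sum_distrib_right sum.distrib[symmetric]
    by (intro sum.cong)
      (simp_all add: derivation_mult[OF derivation_mpoly_pderiv] arc.hom_add arc.hom_mult algebra_simps)
  have expand: "s * t - w * x - (b * t' + s' * c) =
      s * (t - x - t') + (s - w - s') * x + (s - b) * t' + (x - c) * s'" for s t w x b c s' t' :: "'a fps"
    by (simp add: algebra_simps)
  have "?y (f * g) - ?z (f * g) - ?d (f * g) =
     ?y f * (?y g - ?z g - ?d g) + (?y f - ?z f - ?d f) * ?z g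
      + (?y f - ?a f) * ?d g + (?z g - ?a g) * ?d f"
    unfolding d arc.hom_mult by (rule expand)
  also have "p * q dvd \<dots>"
    by (rule dvd_add[OF dvd_add[OF dvd_add[OF dvd_mult[OF mult.IH(2)] dvd_mult2[OF mult.IH(1)]]
            mult_dvd_mono[OF fp q]] mult_dvd_mono[OF gp q]])
  finally show ?case .
qed simp

section \<open>Prime ideals\<close>

lemma module_mult: "Modules.module ((*) :: 'r::comm_ring_1 \<Rightarrow> 'r \<Rightarrow> 'r)"
  by unfold_locales (simp_all add: algebra_simps)

lemma is_ideal_iff:
  "is_ideal I \<longleftrightarrow> 0 \<in> I \<and> (\<forall>x\<in>I. \<forall>y\<in>I. x + y \<in> I) \<and> (\<forall>r. \<forall>x\<in>I. r * x \<in> I)"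
  by (simp add: is_ideal_def module.subspace_def[OF module_mult])

lemma ideal_gen_least: "is_ideal I \<Longrightarrow> S \<subseteq> I \<Longrightarrow> ideal_gen S \<subseteq> I"
  unfolding is_ideal_def ideal_gen_def by (rule module.span_minimal[OF module_mult])

lemma ideal_gen_superset: "S \<subseteq> ideal_gen S"
  unfolding ideal_gen_def by (rule module.span_superset[OF module_mult])

lemma is_idealD:
  assumes "is_ideal I"
  shows "0 \<in> I" "x \<in> I \<Longrightarrow> y \<in> I \<Longrightarrow> x + y \<in> I" "x \<in> I \<Longrightarrow> r * x \<in> I" "x \<in> I \<Longrightarrow> x * r \<in> I"
    "x \<in> I \<Longrightarrow> - x \<in> I" "x \<in> I \<Longrightarrow> y \<in> I \<Longrightarrow> x - y \<in> I"
proof -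
  show "0 \<in> I" and add: "x \<in> I \<Longrightarrow> y \<in> I \<Longrightarrow> x + y \<in> I"
    and mult: "x \<in> I \<Longrightarrow> r * x \<in> I" for x y r
    using assms by (auto simp: is_ideal_iff)
  show "x \<in> I \<Longrightarrow> x * r \<in> I" using mult[of x r] by (simp add: mult.commute)
  show minus: "x \<in> I \<Longrightarrow> - x \<in> I" for x using mult[of x "-1"] by simp
  show "x \<in> I \<Longrightarrow> y \<in> I \<Longrightarrow> x - y \<in> I" using add[of x "- y"] minus[of y] by simp
qed

lemma is_ideal_sum:
  assumes "is_ideal I" "\<And>i. i \<in> A \<Longrightarrow> f i \<in> I"
  shows "sum f A \<in> I"
  using assms(2) by (induction A rule: infinite_finite_induct) (auto intro: is_idealD[OF assms(1)])

lemma is_prime_idealD: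
  assumes "is_prime_ideal P"
  shows "is_ideal P" "1 \<notin> P" "a * b \<in> P \<Longrightarrow> a \<notin> P \<Longrightarrow> b \<in> P"
  using assms by (auto simp: is_prime_ideal_def)

lemma exists_minimal_prime:
  assumes "is_prime_ideal P" "J \<subseteq> P"
  obtains Q where "is_minimal_prime J Q" "Q \<subseteq> P"
proof -
  \<comment> \<open>Complements turn descending chains of primes into ascending ones, as Zorn's
    lemma requires.\<close>
  let ?A = "uminus ` {Q. is_prime_ideal Q \<and> J \<subseteq> Q \<and> Q \<subseteq> P}"
  have "\<exists>M\<in>?A. \<forall>X\<in>?A. M \<subseteq> X \<longrightarrow> X = M"
  proof (rule subset_Zorn_nonempty)
    fix C assume C: "C \<noteq> {}" "subset.chain ?A C"
    let ?I = "- \<Union>C"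
    have CA: "is_prime_ideal (- X) \<and> J \<subseteq> - X \<and> - X \<subseteq> P" if "X \<in> C" for X
      using that C(2) by (auto simp: subset.chain_def)
    have "is_ideal ?I"
      unfolding is_ideal_iff using CA[THEN conjunct1, THEN is_prime_idealD(1)]
      by (auto dest: is_idealD)
    moreover have "1 \<notin> ?I" using CA[THEN conjunct1, THEN is_prime_idealD(2)] C(1) by auto
    moreover have "a \<in> ?I \<or> b \<in> ?I" if "a * b \<in> ?I" for a b
    proof (rule ccontr)
      assume "\<not> (a \<in> ?I \<or> b \<in> ?I)"
      then obtain X Y where XY: "X \<in> C" "Y \<in> C" "a \<in> X" "b \<in> Y" by auto
      then have "X \<subseteq> Y \<or> Y \<subseteq> X"
        using C(2) subset_chain_def[of ?A C] by (metis (no_types))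
      then obtain Z where "Z \<in> C" "a \<in> Z" "b \<in> Z" using XY by blast
      then show False using CA[of Z] is_prime_idealD(3)[of "- Z" a b] that by auto
    qed
    ultimately have "is_prime_ideal ?I" by (auto simp: is_prime_ideal_def)
    moreover have "J \<subseteq> ?I" "?I \<subseteq> P" using CA C(1) by blast+
    ultimately show "\<Union>C \<in> ?A" by (intro image_eqI[of _ _ ?I]) auto
  qed (use assms in blast)
  then obtain X where X: "X \<in> ?A" and max: "\<forall>Y\<in>?A. X \<subseteq> Y \<longrightarrow> Y = X" by (elim bexE)
  from X obtain Q where Q: "is_prime_ideal Q" "J \<subseteq> Q" "Q \<subseteq> P" "X = - Q" by blast
  have "Q' = Q" if Q': "is_prime_ideal Q'" "J \<subseteq> Q'" "Q' \<subseteq> Q" for Q'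
  proof -
    have "- Q' \<in> ?A" using Q' Q(3) by (intro imageI) auto
    then have "- Q' = X" using max Q'(3) Q(4) by blast
    then show ?thesis using Q(4) by simp
  qed
  then have "is_minimal_prime J Q"
    unfolding is_minimal_prime_def using Q by blast
  with Q show thesis using that by blast
qed

lemma Const_in_prime_iff:
  fixes c :: "'a::field" and P :: "('x, 'a) mpoly set"
  assumes "is_prime_ideal P"
  shows "Const c \<in> P \<longleftrightarrow> c = 0"
proof
  assume c: "Const c \<in> P"
  show "c = 0"
  proof (rule ccontr)
    assume "c \<noteq> 0"
    then have "Const (inverse c) * Const c = (1 :: ('x, 'a) mpoly)" by (simp add: mult_single)
    then show False using is_idealD(3)[OF is_prime_idealD(1)[OF assms] c, of "Const (inverse c)"]
      is_prime_idealD(2)[OF assms] by simp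
  qed
qed (use is_idealD(1)[OF is_prime_idealD(1)[OF assms]] in simp)

subsection \<open>Algebraic independence modulo a prime ideal\<close>

definition vars_below :: "nat \<Rightarrow> (nat, 'a::zero) mpoly set" where
  "vars_below s = {p. \<forall>m\<in>Poly_Mapping.keys p. Poly_Mapping.keys m \<subseteq> {..<s}}"

text \<open>For a prime \<open>Q\<close> this says that the transcendence degree of the quotient is
  at least \<open>s\<close>. The family \<open>u\<close> is total, but only its first
  \<open>s\<close> members occur.\<close>

definition has_alg_indep :: "nat \<Rightarrow> ('x, 'a::comm_ring_1) mpoly set \<Rightarrow> bool" where
  "has_alg_indep s Q \<longleftrightarrow> (\<exists>u. \<forall>p\<in>vars_below s. mpoly_subst u p \<in> Q \<longrightarrow> p = 0)"

lemma has_alg_indep_mono: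
  assumes "has_alg_indep s Q" "Q' \<subseteq> Q" "s' \<le> s"
  shows "has_alg_indep s' Q'"
proof -
  have "vars_below s' \<subseteq> vars_below s" using assms(3) unfolding vars_below_def by force
  then show ?thesis using assms unfolding has_alg_indep_def by blast
qed

lemma mpoly_subst_cong:
  assumes "\<And>m v. m \<in> Poly_Mapping.keys p \<Longrightarrow> v \<in> Poly_Mapping.keys m \<Longrightarrow> u v = u' v"
  shows "mpoly_subst u p = mpoly_subst u' p"
  unfolding mpoly_subst_def mpoly_eval_def using assms by (auto intro!: sum.cong prod.cong)

lemma mpoly_split_var:
  fixes p :: "('x, 'a::comm_ring_1) mpoly"
  obtains p0 p1 where "p = p0 + mvar s * p1"
    "\<And>m. m \<in> Poly_Mapping.keys p0 \<Longrightarrow> m \<in> Poly_Mapping.keys p \<and> Poly_Mapping.lookup m s = 0"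
    "\<And>m. m \<in> Poly_Mapping.keys p1 \<Longrightarrow> m + Poly_Mapping.single s 1 \<in> Poly_Mapping.keys p"
proof -
  let ?s = "Poly_Mapping.single" let ?l = "Poly_Mapping.lookup" let ?k = "Poly_Mapping.keys p"
  define A where "A = {m \<in> ?k. ?l m s = 0}"
  define B where "B = {m \<in> ?k. ?l m s \<noteq> 0}"
  define p0 where "p0 = (\<Sum>m\<in>A. ?s m (?l p m))"
  define p1 where "p1 = (\<Sum>m\<in>B. ?s (m - ?s s 1) (?l p m))"
  have fin: "finite A" "finite B" by (auto simp: A_def B_def)
  have sub: "?s s 1 + (m - ?s s 1) = m" if "?l m s \<noteq> 0" for m :: "'x \<Rightarrow>\<^sub>0 nat"
    using that by (intro poly_mapping_eqI) (auto simp: lookup_add lookup_minus lookup_single when_def)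
  have "p = (\<Sum>m\<in>A \<union> B. ?s m (?l p m))"
  proof -
    have "A \<union> B = ?k" by (auto simp: A_def B_def)
    then show ?thesis using poly_mapping_sum_singles[of p] by simp
  qed
  also have "\<dots> = p0 + (\<Sum>m\<in>B. ?s m (?l p m))"
    unfolding p0_def by (rule sum.union_disjoint) (use fin in \<open>auto simp: A_def B_def\<close>)
  also have "(\<Sum>m\<in>B. ?s m (?l p m)) = mvar s * p1"
    unfolding p1_def mvar_def sum_distrib_left
    by (intro sum.cong) (auto simp: mult_single sub B_def simp del: One_nat_def)
  finally have "p = p0 + mvar s * p1" .
  moreover have "m \<in> A" if "m \<in> Poly_Mapping.keys p0" for m
  proof (rule ccontr)
    assume "m \<notin> A"
    then have "?l p0 m = 0" unfolding p0_def lookup_sum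
      by (intro sum.neutral) (auto simp: lookup_single when_def)
    then show False using that by auto
  qed
  moreover have "m + ?s s 1 \<in> ?k" if "m \<in> Poly_Mapping.keys p1" for m
  proof (rule ccontr)
    assume n: "m + ?s s 1 \<notin> ?k"
    have "m' - ?s s 1 \<noteq> m" if "m' \<in> B" for m'
      using n sub[of m'] that by (auto simp: B_def add.commute)
    then have "?l p1 m = 0" unfolding p1_def lookup_sum
      by (intro sum.neutral) (auto simp: lookup_single when_def)
    then show False using that by auto
  qed
  ultimately show thesis using that[of p0 p1] by (auto simp: A_def)
qed

text \<open>An element of \<open>Q1 - Q0\<close> is independent of elements that are independent modulo \<open>Q1\<close>.\<close>

lemma has_alg_indep_psubset:
  fixes Q0 :: "('x, 'a::comm_ring_1) mpoly set"
  assumes Q0: "is_prime_ideal Q0" and Q1: "is_prime_ideal Q1" and "Q0 \<subset> Q1"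
    and ind: "has_alg_indep s Q1"
  shows "has_alg_indep (Suc s) Q0"
proof -
  note i0 = is_prime_idealD(1)[OF Q0] and i1 = is_prime_idealD(1)[OF Q1]
  obtain x where x: "x \<in> Q1" "x \<notin> Q0" using assms by blast
  obtain u where u: "\<And>p. p \<in> vars_below s \<Longrightarrow> mpoly_subst u p \<in> Q1 \<Longrightarrow> p = 0"
    using ind unfolding has_alg_indep_def by blast
  let ?u = "u(s := x)"
  \<comment> \<open>Induction on a strict bound \<open>n\<close> for the degree of the relation in
    the new variable \<open>s\<close>, for which \<open>x\<close> is substituted.\<close>
  have "p = 0" if "\<And>m. m \<in> Poly_Mapping.keys p \<Longrightarrow> Poly_Mapping.lookup m s < n"
    "p \<in> vars_below (Suc s)" "mpoly_subst ?u p \<in> Q0" for p n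
    using that
  proof (induction n arbitrary: p)
    case 0
    then have "Poly_Mapping.keys p = {}" by blast
    then show ?case by simp
  next
    case (Suc n)
    obtain p0 p1 where p: "p = p0 + mvar s * p1"
      and p0: "\<And>m. m \<in> Poly_Mapping.keys p0 \<Longrightarrow> m \<in> Poly_Mapping.keys p \<and> Poly_Mapping.lookup m s = 0"
      and p1: "\<And>m. m \<in> Poly_Mapping.keys p1 \<Longrightarrow> m + Poly_Mapping.single s 1 \<in> Poly_Mapping.keys p"
      using mpoly_split_var[of p s] by metis
    have ev: "mpoly_subst ?u p = mpoly_subst ?u p0 + x * mpoly_subst ?u p1"
      by (simp add: p subst.hom_add subst.hom_mult)
    have "mpoly_subst ?u p0 = mpoly_subst u p0"
      using p0 by (intro mpoly_subst_cong) (auto simp: in_keys_iff)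
    moreover have "mpoly_subst ?u p0 \<in> Q1"
    proof -
      have "mpoly_subst ?u p \<in> Q1" using Suc.prems(3) \<open>Q0 \<subset> Q1\<close> by blast
      then have "mpoly_subst ?u p - x * mpoly_subst ?u p1 \<in> Q1"
        using is_idealD(4,6)[OF i1] x(1) by blast
      then show ?thesis by (simp add: ev del: fun_upd_apply)
    qed
    moreover have "p0 \<in> vars_below s"
    proof -
      have "v < s" if "m \<in> Poly_Mapping.keys p0" "v \<in> Poly_Mapping.keys m" for m v
      proof -
        have "v < Suc s" using p0[OF that(1)] that(2) Suc.prems(2) unfolding vars_below_def by blast
        moreover have "v \<noteq> s" using p0[OF that(1)] that(2) by (auto simp: in_keys_iff)
        ultimately show ?thesis by simp
      qed
      then show ?thesis by (auto simp: vars_below_def)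
    qed
    ultimately have "p0 = 0" using u by simp
    \<comment> \<open>The part \<open>p0\<close> was a relation modulo \<open>Q1\<close>, where
      \<open>x\<close> vanishes. Now \<open>x\<close> can be cancelled modulo the prime
      \<open>Q0\<close>, and the degree drops.\<close>
    then have "x * mpoly_subst ?u p1 \<in> Q0" 
      using Suc.prems(3) ev by (simp add: subst.hom_zero del: fun_upd_apply)
    then have "mpoly_subst ?u p1 \<in> Q0" using x(2) is_prime_idealD(3)[OF Q0] by blast
    moreover have "Poly_Mapping.lookup m s < n" if "m \<in> Poly_Mapping.keys p1" for m
      using Suc.prems(1)[OF p1[OF that]] by (simp add: lookup_add)
    moreover have "p1 \<in> vars_below (Suc s)"
    proof -
      have "v < Suc s" if "m \<in> Poly_Mapping.keys p1" "v \<in> Poly_Mapping.keys m" for m v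
      proof -
        have "v \<in> Poly_Mapping.keys (m + Poly_Mapping.single s 1)"
          using that(2) by (auto simp: in_keys_iff lookup_add)
        then show ?thesis using p1[OF that(1)] Suc.prems(2) unfolding vars_below_def by blast
      qed
      then show ?thesis by (auto simp: vars_below_def)
    qed
    ultimately have "p1 = 0" using Suc.IH by blast
    with \<open>p0 = 0\<close> p show ?case by simp
  qed
  moreover have "\<exists>n. \<forall>m\<in>Poly_Mapping.keys p. Poly_Mapping.lookup m s < n" for p :: "(nat, 'a) mpoly"
    using finite_nat_set_iff_bounded[of "(\<lambda>m. Poly_Mapping.lookup m s) ` Poly_Mapping.keys p"] by auto
  ultimately show ?thesis unfolding has_alg_indep_def by meson
qed

lemma has_alg_indep_zero:
  fixes Q :: "('x, 'a::field) mpoly set"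
  assumes "is_prime_ideal Q"
  shows "has_alg_indep 0 Q"
proof -
  have "p = 0" if "p \<in> vars_below 0" "mpoly_subst (\<lambda>_. 0) p \<in> Q" for p :: "(nat, 'a) mpoly"
  proof -
    have "Poly_Mapping.keys p \<subseteq> {0}" using that(1) by (auto simp: vars_below_def)
    then have "p = Const (Poly_Mapping.lookup p 0)"
      by (intro poly_mapping_eqI) (auto simp: lookup_single when_def in_keys_iff)
    then show ?thesis using that(2) Const_in_prime_iff[OF assms]
      by (metis mpoly_subst_simps(1) single_zero)
  qed
  then show ?thesis unfolding has_alg_indep_def by blast
qed

lemma has_alg_indep_prime_chain:
  fixes Q :: "nat \<Rightarrow> ('x, 'a::field) mpoly set"
  assumes "\<And>i. i \<le> l \<Longrightarrow> is_prime_ideal (Q i)" "\<And>i. i < l \<Longrightarrow> Q i \<subset> Q (Suc i)"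
  shows "has_alg_indep l (Q 0)"
proof -
  have "has_alg_indep i (Q (l - i))" if "i \<le> l" for i
    using that
  proof (induction i)
    case (Suc i)
    then show ?case
      using has_alg_indep_psubset[of "Q (l - Suc i)" "Q (l - i)" i] assms(1)[of "l - i"]
        assms(1)[of "l - Suc i"] assms(2)[of "l - Suc i"]
      by (simp add: Suc_diff_Suc)
  qed (use assms(1)[of l] has_alg_indep_zero in auto)
  from this[of l] show ?thesis by simp
qed

text \<open>The supremum yields a chain of length at least \<open>d\<close> whose members contain
  \<open>Q\<close>. Elements independent modulo its bottom are independent modulo
  \<open>Q\<close>.\<close>

lemma has_alg_indep_quotient_dim:
  fixes Q :: "('x, 'a::field) mpoly set"
  assumes "is_prime_ideal Q" "quotient_dim Q = enat d"
  shows "has_alg_indep d Q"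
proof (cases d)
  case 0
  then show ?thesis using assms has_alg_indep_zero by blast
next
  case (Suc k)
  then have "enat k < quotient_dim Q" using assms(2) by simp
  then obtain l R where l: "k < l" and R: "\<And>i. i \<le> l \<Longrightarrow> is_prime_ideal (R i) \<and> Q \<subseteq> R i"
    "\<And>i. i < l \<Longrightarrow> R i \<subset> R (Suc i)"
    unfolding quotient_dim_def less_SUP_iff by auto
  have "has_alg_indep l (R 0)" using R by (intro has_alg_indep_prime_chain) auto
  then show ?thesis using R(1)[of 0] l Suc by (auto intro: has_alg_indep_mono)
qed

section \<open>Counting monomials: at most as many independent elements as variables\<close>

lemma exists_kernel_vector:
  fixes c :: "'i \<Rightarrow> 'j \<Rightarrow> 'a::field"
  assumes "finite B" "finite A" "card B < card A"
  shows "\<exists>x. (\<exists>a\<in>A. x a \<noteq> 0) \<and> (\<forall>b\<in>B. (\<Sum>a\<in>A. x a * c a b) = 0)"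
  using assms
proof (induction B arbitrary: A c)
  case empty
  then have "A \<noteq> {}" by auto
  then show ?case by (intro exI[of _ "\<lambda>_. 1"]) auto
next
  case (insert b B)
  show ?case
  proof (cases "\<forall>a\<in>A. c a b = 0")
    case True
    then show ?thesis using insert.IH[of A c] insert.prems insert.hyps by auto
  next
    case False
    then obtain a0 where a0: "a0 \<in> A" "c a0 b \<noteq> 0" by auto
    let ?A = "A - {a0}" let ?r = "\<lambda>a. c a b / c a0 b"
    have "card B < card ?A" using insert.prems insert.hyps a0(1) by simp
    then obtain x where x: "\<exists>a\<in>?A. x a \<noteq> 0"
      "\<And>b'. b' \<in> B \<Longrightarrow> (\<Sum>a\<in>?A. x a * (c a b' - ?r a * c a0 b')) = 0"
      using insert.IH[of ?A "\<lambda>a b'. c a b' - ?r a * c a0 b'"] insert.prems(1) by blast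
    \<comment> \<open>The pivot coordinate is the one forced by equation \<open>b\<close>;
      substituting it into the other equations gives the reduced system solved by
      \<open>x\<close>.\<close>
    define y where "y = x(a0 := - (\<Sum>a\<in>?A. x a * ?r a))"
    have y: "(\<Sum>a\<in>A. y a * c a b') = (\<Sum>a\<in>?A. x a * (c a b' - ?r a * c a0 b'))" for b'
    proof -
      have "(\<Sum>a\<in>A. y a * c a b') = y a0 * c a0 b' + (\<Sum>a\<in>?A. x a * c a b')"
        using sum.remove[OF insert.prems(1) a0(1), of "\<lambda>a. y a * c a b'"] by (simp add: y_def)
      also have "y a0 * c a0 b' = - (\<Sum>a\<in>?A. x a * (?r a * c a0 b'))"
        by (simp add: y_def sum_distrib_right mult.assoc)
      finally show ?thesis by (simp add: right_diff_distrib sum_subtractf)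
    qed
    have "(\<Sum>a\<in>A. y a * c a b') = 0" if "b' \<in> insert b B" for b'
      using that x(2) a0(2) unfolding y by auto
    moreover have "\<exists>a\<in>A. y a \<noteq> 0" using x(1) by (auto simp: y_def)
    ultimately show ?thesis by blast
  qed
qed

lemma lookup_Const_mult:
  fixes q :: "('x, 'a::comm_ring_1) mpoly"
  shows "Poly_Mapping.lookup (Const c * q) m = c * Poly_Mapping.lookup q m"
  by (simp add: Poly_Mapping.map.rep_eq when_def flip: mult_map_scale_conv_mult)

text \<open>Bounding each exponent instead of the total degree makes the admissible monomials a box,
  which is counted as a set of functions.\<close>

definition exponents_le :: "nat \<Rightarrow> ('x, 'a::zero) mpoly set" where
  "exponents_le k = {p. \<forall>m\<in>Poly_Mapping.keys p. \<forall>v. Poly_Mapping.lookup m v \<le> k}"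

lemma exponents_le_mult:
  fixes p q :: "('x, 'a::comm_ring_1) mpoly"
  assumes "p \<in> exponents_le k" "q \<in> exponents_le l"
  shows "p * q \<in> exponents_le (k + l)"
  using assms keys_mult[of p q] unfolding exponents_le_def
  by (fastforce simp: lookup_add intro: add_mono)

lemma exponents_le_one: "(1 :: ('x, 'a::comm_ring_1) mpoly) \<in> exponents_le k"
  by (simp add: exponents_le_def)

lemma exponents_le_power:
  fixes p :: "('x, 'a::comm_ring_1) mpoly"
  shows "p \<in> exponents_le k \<Longrightarrow> p ^ j \<in> exponents_le (j * k)"
  by (induction j) (auto simp: exponents_le_one intro: exponents_le_mult)

lemma exponents_le_prod:
  fixes p :: "'i \<Rightarrow> ('x, 'a::comm_ring_1) mpoly"
  shows "(\<And>i. i \<in> A \<Longrightarrow> p i \<in> exponents_le k) \<Longrightarrow> prod p A \<in> exponents_le (card A * k)"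
  by (induction A rule: infinite_finite_induct) (auto simp: exponents_le_one intro: exponents_le_mult)

lemma exponents_le_mono: "k \<le> l \<Longrightarrow> exponents_le k \<subseteq> exponents_le l"
  unfolding exponents_le_def by (auto intro: order_trans)

lemma exists_exponents_le:
  fixes p :: "('x::finite, 'a::comm_ring_1) mpoly"
  shows "\<exists>k. p \<in> exponents_le k"
proof -
  have "finite (\<Union>m\<in>Poly_Mapping.keys p. range (Poly_Mapping.lookup m))" by auto
  then obtain k where "\<forall>i\<in>(\<Union>m\<in>Poly_Mapping.keys p. range (Poly_Mapping.lookup m)). i \<le> k"
    using finite_nat_set_iff_bounded_le by blast
  then show ?thesis by (auto simp: exponents_le_def)
qed

text \<open>The \<open>t^s\<close> products of powers of \<open>u 0, \<dots>, u (s - 1)\<close> with exponents below \<open>t\<close>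
  lie in a space whose dimension is polynomial in \<open>t\<close> of degree \<open>CARD('n)\<close>.\<close>

lemma has_alg_indep_le_card:
  fixes Q :: "('n::finite, 'a::field) mpoly set"
  assumes "0 \<in> Q" "has_alg_indep s Q"
  shows "s \<le> CARD('n)"
proof (rule ccontr)
  assume "\<not> s \<le> CARD('n)"
  obtain u where u: "\<And>p. p \<in> vars_below s \<Longrightarrow> mpoly_subst u p \<in> Q \<Longrightarrow> p = 0"
    using assms unfolding has_alg_indep_def by blast
  obtain k where k: "u i \<in> exponents_le (k i)" for i
    using choice[of "\<lambda>i k. u i \<in> exponents_le k"] exists_exponents_le by blast
  define b where "b = (\<Sum>i<s. k i)"
  have b: "u i \<in> exponents_le b" if "i < s" for i
    using k[of i] exponents_le_mono[of "k i" b] member_le_sum[of i "{..<s}" k] that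
    by (auto simp: b_def)
  \<comment> \<open>With \<open>K = s * (t * b)\<close> there are at most
    \<open>(s * b + 1) ^ CARD('n) * t ^ CARD('n)\<close> monomials. Taking \<open>t\<close> larger
    than the first factor makes this less than \<open>t ^ (CARD('n) + 1)\<close>, which is at most
    \<open>t ^ s\<close>.\<close>
  define t where "t = (s * b + 1) ^ CARD('n) + 1"
  define A where "A = ({..<s} \<rightarrow>\<^sub>E {..<t})"
  define K where "K = s * (t * b)"
  define mon where "mon e = (\<Sum>i<s. Poly_Mapping.single i (e i :: nat))" for e
  define B where "B = (\<lambda>g :: 'n \<Rightarrow> nat. \<Sum>v\<in>UNIV. Poly_Mapping.single v (g v)) ` (UNIV \<rightarrow>\<^sub>E {..K})"
  have lookup_mon: "Poly_Mapping.lookup (mon e) i = (if i < s then e i else 0)" for e i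
    by (auto simp: mon_def lookup_sum lookup_single when_def sum.delta)
  have B: "m \<in> B" if "\<And>v. Poly_Mapping.lookup m v \<le> K" for m
    unfolding B_def using that
    by (intro image_eqI[of _ _ "Poly_Mapping.lookup m"])
      (auto intro!: poly_mapping_eqI simp: lookup_sum lookup_single when_def sum.delta)
  have t: "t \<ge> 1" by (simp add: t_def)
  have "card B \<le> card ((UNIV :: 'n set) \<rightarrow>\<^sub>E {..K})"
    unfolding B_def by (intro card_image_le finite_PiE) auto
  also have "\<dots> = (K + 1) ^ CARD('n)" by (subst card_PiE) auto
  also have "\<dots> \<le> ((s * b + 1) * t) ^ CARD('n)"
    using t by (intro power_mono) (auto simp: K_def algebra_simps)
  also have "\<dots> < t * t ^ CARD('n)"
    unfolding power_mult_distrib by (intro mult_strict_right_mono) (auto simp: t_def)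
  also have "\<dots> \<le> t ^ s"
    using power_increasing[of "Suc (CARD('n))" s t] \<open>\<not> s \<le> CARD('n)\<close> by (simp add: t_def)
  also have "\<dots> = card A" unfolding A_def by (subst card_PiE) auto
  finally have card: "card B < card A" .
  have fin: "finite A" "finite B" unfolding A_def B_def by (auto intro!: finite_PiE)
  obtain x where "\<exists>e\<in>A. x e \<noteq> 0"
    and kernel: "\<forall>m\<in>B. (\<Sum>e\<in>A. x e * Poly_Mapping.lookup (monom_eval u (mon e)) m) = 0"
    using exists_kernel_vector[OF fin(2,1) card, of "\<lambda>e m. Poly_Mapping.lookup (monom_eval u (mon e)) m"]
    by (elim exE conjE)
  then obtain e0 where x: "e0 \<in> A" "x e0 \<noteq> 0" by blast
  \<comment> \<open>A nonzero kernel vector is a polynomial relation: all coefficients of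
    \<open>mpoly_subst u p\<close> vanish, those outside \<open>B\<close> because of the bound on
    the exponents.\<close>
  define p where "p = (\<Sum>e\<in>A. Poly_Mapping.single (mon e) (x e))"
  have inj: "e = e'" if "e \<in> A" "e' \<in> A" "mon e = mon e'" for e e'
  proof (rule PiE_ext[OF that(1,2)[unfolded A_def]])
    fix i assume "i \<in> {..<s}"
    then show "e i = e' i" using arg_cong[OF that(3), of "\<lambda>m. Poly_Mapping.lookup m i"]
      by (simp add: lookup_mon)
  qed
  have "Poly_Mapping.lookup p (mon e0) = (\<Sum>e\<in>A. if e = e0 then x e else 0)"
    unfolding p_def lookup_sum using inj x(1)
    by (intro sum.cong) (auto simp: lookup_single when_def)
  then have "p \<noteq> 0" using x fin by (auto simp: sum.delta)
  moreover have "p \<in> vars_below s"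
  proof -
    have "\<exists>e. m = mon e" if "m \<in> Poly_Mapping.keys p" for m
    proof (rule ccontr)
      assume "\<nexists>e. m = mon e"
      then have "Poly_Mapping.lookup p m = 0" unfolding p_def lookup_sum
        by (intro sum.neutral) (auto simp: lookup_single when_def)
      then show False using that by auto
    qed
    moreover have "Poly_Mapping.keys (mon e) \<subseteq> {..<s}" for e
      by (auto simp: in_keys_iff lookup_mon split: if_splits)
    ultimately show ?thesis unfolding vars_below_def by blast
  qed
  moreover have "mpoly_subst u p = 0"
  proof (rule poly_mapping_eqI)
    fix m
    have "Poly_Mapping.lookup (mpoly_subst u p) m =
        (\<Sum>e\<in>A. x e * Poly_Mapping.lookup (monom_eval u (mon e)) m)"
      unfolding p_def subst.hom_sum mpoly_subst_single lookup_sum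
      by (simp add: lookup_Const_mult)
    also have "\<dots> = 0"
    proof (cases "m \<in> B")
      case False
      have "Poly_Mapping.lookup (monom_eval u (mon e)) m = 0" if "e \<in> A" for e
      proof -
        have "monom_eval u (mon e) = (\<Prod>i<s. u i ^ e i)"
          by (subst monom_eval_superset[of "{..<s}"]) (auto simp: in_keys_iff lookup_mon split: if_splits)
        moreover have "u i ^ e i \<in> exponents_le (t * b)" if "i < s" for i
        proof -
          have "e i \<le> t" using \<open>e \<in> A\<close> that by (auto simp: A_def PiE_def Pi_def intro: less_imp_le)
          then show ?thesis using exponents_le_power[OF b[OF that], of "e i"]
              exponents_le_mono[of "e i * b" "t * b"] by auto
        qed
        ultimately have "monom_eval u (mon e) \<in> exponents_le K"
          using exponents_le_prod[of "{..<s}" "\<lambda>i. u i ^ e i" "t * b"] by (simp add: K_def)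
        then have "m \<notin> Poly_Mapping.keys (monom_eval u (mon e))"
          using False B[of m] unfolding exponents_le_def by blast
        then show ?thesis by (simp add: in_keys_iff)
      qed
      then show ?thesis by simp
    qed (use kernel in simp)
    finally show "Poly_Mapping.lookup (mpoly_subst u p) m = Poly_Mapping.lookup 0 m" by simp
  qed
  ultimately show False using u assms(1) by metis
qed

section \<open>Differential prime ideals\<close>

text \<open>Arbitrary words \<open>ds\<close> occur because the derivations need not commute. For
  derivations and an ideal \<open>Q\<close> the result is the largest stable ideal inside
  \<open>Q\<close>.\<close>

definition diff_core :: "('r \<Rightarrow> 'r) set \<Rightarrow> 'r set \<Rightarrow> 'r set" where
  "diff_core DD Q = {h. \<forall>ds. set ds \<subseteq> DD \<longrightarrow> foldr (\<lambda>D. D) ds h \<in> Q}"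

lemma diff_core_subset: "diff_core DD Q \<subseteq> Q"
proof
  fix h assume "h \<in> diff_core DD Q"
  then have "foldr (\<lambda>D. D) [] h \<in> Q" unfolding diff_core_def by (metis (no_types, lifting) empty_set empty_subsetI mem_Collect_eq)
  then show "h \<in> Q" by simp
qed

lemma diff_core_mono: "DD' \<subseteq> DD \<Longrightarrow> Q \<subseteq> Q' \<Longrightarrow> diff_core DD Q \<subseteq> diff_core DD' Q'"
  unfolding diff_core_def by blast

lemma diff_core_stable:
  assumes "D \<in> DD" "h \<in> diff_core DD Q"
  shows "D h \<in> diff_core DD Q"
proof -
  have "foldr (\<lambda>D. D) ds (D h) \<in> Q" if "set ds \<subseteq> DD" for ds
  proof -
    have "foldr (\<lambda>D. D) (ds @ [D]) h \<in> Q"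
      using that assms unfolding diff_core_def by (auto simp del: foldr_append)
    then show ?thesis by simp
  qed
  then show ?thesis by (simp add: diff_core_def)
qed

lemma diff_core_greatest:
  assumes "P \<subseteq> Q" "\<And>D h. D \<in> DD \<Longrightarrow> h \<in> P \<Longrightarrow> D h \<in> P"
  shows "P \<subseteq> diff_core DD Q"
proof -
  have "foldr (\<lambda>D. D) ds h \<in> P" if "set ds \<subseteq> DD" "h \<in> P" for ds h
    using that by (induction ds) (auto intro: assms(2))
  then show ?thesis using assms(1) by (auto simp: diff_core_def)
qed

lemma is_ideal_diff_core:
  assumes I: "is_ideal I" and D: "\<And>D. D \<in> DD \<Longrightarrow> derivation D"
  shows "is_ideal (diff_core DD I)"
proof -
  have zero: "foldr (\<lambda>D. D) ds 0 = 0" if "set ds \<subseteq> DD" for ds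
    using that by (induction ds) (auto simp: derivation_zero[OF D])
  have add: "foldr (\<lambda>D. D) ds (x + y) = foldr (\<lambda>D. D) ds x + foldr (\<lambda>D. D) ds y"
    if "set ds \<subseteq> DD" for ds x y
    using that by (induction ds) (auto simp: derivation_add[OF D])
  have "foldr (\<lambda>D. D) ds (r * x) \<in> I" if "set ds \<subseteq> DD" "x \<in> diff_core DD I" for ds r x
    using that
  \<comment> \<open>The derivation that acts first is split off: \<open>r * D x\<close> and
    \<open>D r * x\<close> are again multiples of elements of the core, and only the shorter word
    remains to be applied.\<close>
  proof (induction ds arbitrary: r x rule: rev_induct)
    case Nil
    then show ?case using diff_core_subset[of DD I] is_idealD(3)[OF I] by auto
  next
    case (snoc D ds)
    have "foldr (\<lambda>D. D) (ds @ [D]) (r * x) =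
        foldr (\<lambda>D. D) ds (r * D x) + foldr (\<lambda>D. D) ds (D r * x)"
      using snoc.prems by (simp add: derivation_mult[OF D] add)
    then show ?case using snoc diff_core_stable[of D DD x I] is_idealD(2)[OF I] by simp
  qed
  then show ?thesis
    using is_idealD(1,2)[OF I] unfolding is_ideal_iff
    by (auto simp: diff_core_def zero add)
qed

lemma foldr_singleton: "set ds \<subseteq> {D} \<Longrightarrow> foldr (\<lambda>D. D) ds = D ^^ length ds"
  by (induction ds) auto

lemma diff_core_singleton: "h \<in> diff_core {D} Q \<longleftrightarrow> (\<forall>i. (D ^^ i) h \<in> Q)"
proof
  assume h: "h \<in> diff_core {D} Q"
  show "\<forall>i. (D ^^ i) h \<in> Q"
  proof
    fix i
    have sub: "set (replicate i D) \<subseteq> {D}" by auto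
    then have "foldr (\<lambda>D. D) (replicate i D) h \<in> Q" using h unfolding diff_core_def by blast
    then show "(D ^^ i) h \<in> Q" unfolding foldr_singleton[OF sub] length_replicate .
  qed
qed (auto simp: diff_core_def foldr_singleton)

lemma derivation_funpow_mult:
  assumes D: "derivation D"
  shows "(D ^^ n) (x * y) = (\<Sum>i\<le>n. of_nat (n choose i) * ((D ^^ i) x * (D ^^ (n - i)) y))"
proof (induction n)
  case (Suc n)
  have nat: "D (of_nat k * z) = of_nat k * D z" for k z
    by (induction k) (auto simp: derivation_zero[OF D] derivation_add[OF D] algebra_simps)
  have sum: "D (sum g A) = (\<Sum>i\<in>A. D (g i))" for g :: "nat \<Rightarrow> 'a" and A
    by (induction A rule: infinite_finite_induct) (auto simp: derivation_zero[OF D] derivation_add[OF D])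
  let ?f = "\<lambda>i. (D ^^ i) x * (D ^^ (Suc n - i)) y"
  have "(D ^^ Suc n) (x * y) =
      (\<Sum>i\<le>n. of_nat (n choose i) * D ((D ^^ i) x * (D ^^ (n - i)) y))"
    by (simp add: Suc.IH sum nat)
  also have "\<dots> = (\<Sum>i\<le>n. of_nat (n choose i) * ?f i) + (\<Sum>i\<le>n. of_nat (n choose i) * ?f (Suc i))"
    by (simp add: derivation_mult[OF D] distrib_left sum.distrib Suc_diff_le)
  also have "(\<Sum>i\<le>n. of_nat (n choose i) * ?f i) =
      ?f 0 + (\<Sum>i\<le>n. of_nat (n choose Suc i) * ?f (Suc i))"
    using sum.atMost_Suc_shift[of "\<lambda>i. of_nat (n choose i) * ?f i" n]
    by (simp add: binomial_eq_0)
  finally have "(D ^^ Suc n) (x * y) = ?f 0 + (\<Sum>i\<le>n. of_nat (Suc n choose Suc i) * ?f (Suc i))"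
    by (simp add: distrib_right sum.distrib add_ac)
  then show ?case
    unfolding sum.atMost_Suc_shift by simp
qed simp

text \<open>If \<open>i\<close> and \<open>j\<close> are the first orders at which derivatives of
  \<open>a\<close> and \<open>b\<close> leave \<open>Q\<close>, then all terms but one in the
  Leibniz expansion of \<open>(D ^^ (i + j)) (a * b)\<close> lie in \<open>Q\<close>. The binomial
  coefficient of the remaining one is cancelled by \<open>char\<close>.\<close>

lemma is_prime_ideal_diff_core_singleton:
  assumes Q: "is_prime_ideal Q" and D: "derivation D"
    and char: "\<And>k x. k > 0 \<Longrightarrow> of_nat k * x \<in> Q \<Longrightarrow> x \<in> Q"
  shows "is_prime_ideal (diff_core {D} Q)"
proof -
  note iQ = is_prime_idealD(1)[OF Q]
  have "a \<in> diff_core {D} Q \<or> b \<in> diff_core {D} Q" if "a * b \<in> diff_core {D} Q" for a b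
  proof (rule ccontr)
    assume "\<not> (a \<in> diff_core {D} Q \<or> b \<in> diff_core {D} Q)"
    then have ex: "\<exists>i. (D ^^ i) a \<notin> Q" "\<exists>j. (D ^^ j) b \<notin> Q" by (auto simp: diff_core_singleton)
    define i where "i = (LEAST i. (D ^^ i) a \<notin> Q)"
    define j where "j = (LEAST j. (D ^^ j) b \<notin> Q)"
    have ij: "(D ^^ i) a \<notin> Q" "(D ^^ j) b \<notin> Q"
      unfolding i_def j_def using LeastI_ex[OF ex(1)] LeastI_ex[OF ex(2)] .
    have min: "k < i \<Longrightarrow> (D ^^ k) a \<in> Q" "k < j \<Longrightarrow> (D ^^ k) b \<in> Q" for k
      using not_less_Least[of k "\<lambda>i. (D ^^ i) a \<notin> Q"] not_less_Least[of k "\<lambda>j. (D ^^ j) b \<notin> Q"]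
      unfolding i_def j_def by simp_all
    let ?t = "\<lambda>k. of_nat ((i + j) choose k) * ((D ^^ k) a * (D ^^ (i + j - k)) b)"
    have "?t k \<in> Q" if "k \<in> {..i + j} - {i}" for k
    proof -
      have "k < i \<or> i + j - k < j" using that by auto
      then have "(D ^^ k) a \<in> Q \<or> (D ^^ (i + j - k)) b \<in> Q" using min by blast
      then show ?thesis using iQ by (auto simp: is_idealD(3,4))
    qed
    then have "sum ?t ({..i + j} - {i}) \<in> Q" by (rule is_ideal_sum[OF iQ])
    moreover have "sum ?t {..i + j} \<in> Q"
      using that unfolding diff_core_singleton derivation_funpow_mult[OF D] by blast
    moreover have "sum ?t {..i + j} = ?t i + sum ?t ({..i + j} - {i})"
      by (rule sum.remove) auto
    ultimately have "?t i + sum ?t ({..i + j} - {i}) - sum ?t ({..i + j} - {i}) \<in> Q"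
      by (intro is_idealD(6)[OF iQ]) (simp_all only:)
    then have "?t i \<in> Q" by (simp only: add_diff_cancel_right')
    then have "(D ^^ i) a * (D ^^ j) b \<in> Q" using char[of "(i + j) choose i"] by (simp add: zero_less_binomial)
    then show False using ij is_prime_idealD(3)[OF Q] by blast
  qed
  moreover have "1 \<notin> diff_core {D} Q" using is_prime_idealD(2)[OF Q] diff_core_subset[of "{D}" Q] by blast
  ultimately show ?thesis
    using is_ideal_diff_core[OF iQ, of "{D}"] D by (auto simp: is_prime_ideal_def)
qed

text \<open>A minimal prime \<open>P\<close> over \<open>diff_core DD Q\<close> inside \<open>Q\<close> coincides with
  the prime \<open>diff_core {D} P\<close> for each single \<open>D\<close>, so it is stable under all of \<open>DD\<close>.\<close>

lemma is_prime_ideal_diff_core: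
  fixes Q :: "'r::comm_ring_1 set"
  assumes Q: "is_prime_ideal Q" and D: "\<And>D. D \<in> DD \<Longrightarrow> derivation D"
    and char: "\<And>(P :: 'r set) k x. is_prime_ideal P \<Longrightarrow> k > 0 \<Longrightarrow> of_nat k * x \<in> P \<Longrightarrow> x \<in> P"
  shows "is_prime_ideal (diff_core DD Q)"
proof -
  obtain P where P: "is_minimal_prime (diff_core DD Q) P" "P \<subseteq> Q"
    using exists_minimal_prime[OF Q diff_core_subset] by blast
  then have prime: "is_prime_ideal P" and sub: "diff_core DD Q \<subseteq> P"
    by (auto simp: is_minimal_prime_def)
  have "D h \<in> P" if "D \<in> DD" "h \<in> P" for D h
  proof -
    have "diff_core DD Q \<subseteq> diff_core {D} P"
      using sub diff_core_stable[OF that(1), of _ Q] by (intro diff_core_greatest) auto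
    then have "diff_core {D} P = P"
      using P is_prime_ideal_diff_core_singleton[OF prime D[OF that(1)] char[OF prime]]
        diff_core_subset[of "{D}" P]
      by (auto simp: is_minimal_prime_def)
    then show ?thesis using diff_core_stable[of D "{D}" h P] that(2) by auto
  qed
  then have "P \<subseteq> diff_core DD Q" using P by (intro diff_core_greatest)
  then show ?thesis using sub prime by auto
qed

lemma of_nat_mult_in_prime:
  fixes P :: "('x, 'a::field_char_0) mpoly set"
  assumes "is_prime_ideal P" "k > 0" "of_nat k * x \<in> P"
  shows "x \<in> P"
proof -
  have "of_nat k \<notin> P"
    using Const_in_prime_iff[OF assms(1), of "of_nat k"] assms(2) by simp
  then show ?thesis using is_prime_idealD(3)[OF assms(1,3)] by blast
qed

section \<open>Primes outside the vanishing locus of a Jacobian minor\<close>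

lemma lookup_mpoly_pderiv:
  fixes p :: "('x, 'a::comm_ring_1) mpoly"
  shows "Poly_Mapping.lookup (mpoly_pderiv v p) m =
    of_nat (Suc (Poly_Mapping.lookup m v)) * Poly_Mapping.lookup p (m + Poly_Mapping.single v 1)"
proof -
  have iff: "Poly_Mapping.lookup k v \<noteq> 0 \<and> k - Poly_Mapping.single v 1 = m \<longleftrightarrow>
      k = m + Poly_Mapping.single v 1" for k :: "'x \<Rightarrow>\<^sub>0 nat"
    by (auto simp: poly_mapping_eq_iff fun_eq_iff lookup_add lookup_minus lookup_single when_def)
  have "Poly_Mapping.lookup (mpoly_pderiv v p) m = (\<Sum>k\<in>Poly_Mapping.keys p.
      if k = m + Poly_Mapping.single v 1
      then of_nat (Suc (Poly_Mapping.lookup m v)) * Poly_Mapping.lookup p k else 0)"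
    unfolding mpoly_pderiv_def lookup_sum
  proof (intro sum.cong refl)
    fix k
    show "Poly_Mapping.lookup (Poly_Mapping.single (k - Poly_Mapping.single v 1)
        (of_nat (Poly_Mapping.lookup k v) * Poly_Mapping.lookup p k)) m =
      (if k = m + Poly_Mapping.single v 1
      then of_nat (Suc (Poly_Mapping.lookup m v)) * Poly_Mapping.lookup p k else 0)"
      using iff[of k] by (cases "Poly_Mapping.lookup k v = 0")
        (auto simp: lookup_single when_def lookup_add)
  qed
  then show ?thesis by (simp add: sum.delta in_keys_iff)
qed

text \<open>The polynomials \<open>A v i\<close> are the entries of the adjugate of the square matrix of the
  derivatives of \<open>F 0, \<dots>, F (m - 1)\<close> by the variables in \<open>C\<close>, and \<open>G\<close> is its determinant.\<close>

locale jacobian_minor =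
  fixes F :: "nat \<Rightarrow> ('n::finite, 'a::field_char_0) mpoly" and m :: nat and C :: "'n set"
    and A :: "'n \<Rightarrow> nat \<Rightarrow> ('n, 'a) mpoly" and G :: "('n, 'a) mpoly"
  assumes card_C: "card C = m"
    and adj_left: "\<And>v w. v \<in> C \<Longrightarrow> w \<in> C \<Longrightarrow>
      (\<Sum>i<m. A v i * mpoly_pderiv w (F i)) = (if v = w then G else 0)"
    and adj_right: "\<And>i j. i < m \<Longrightarrow> j < m \<Longrightarrow>
      (\<Sum>v\<in>C. A v i * mpoly_pderiv v (F j)) = (if i = j then G else 0)"
begin

definition minor :: "'n \<Rightarrow> 'n \<Rightarrow> ('n, 'a) mpoly" where
  "minor v w = (\<Sum>i<m. A v i * mpoly_pderiv w (F i))"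

definition ders :: "nat \<Rightarrow> (('n, 'a) mpoly \<Rightarrow> ('n, 'a) mpoly) set" where
  "ders k = {D. derivation D \<and> (\<forall>a. D (Const a) = 0) \<and> (\<forall>j<k. D (F j) = 0)}"

lemma prime_diff_core:
  "is_prime_ideal Q \<Longrightarrow> is_prime_ideal (diff_core (ders k) Q)"
  by (rule is_prime_ideal_diff_core) (auto simp: ders_def intro: of_nat_mult_in_prime)

lemma F_in_diff_core:
  assumes "is_ideal Q" "F i \<in> Q" "i < k"
  shows "F i \<in> diff_core (ders k) Q"
proof -
  have zero: "foldr (\<lambda>D. D) ds 0 = 0" if "set ds \<subseteq> ders k" for ds
    using that by (induction ds) (auto simp: ders_def derivation_zero)
  have "foldr (\<lambda>D. D) ds (F i) \<in> Q" if "set ds \<subseteq> ders k" for ds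
  proof (cases ds rule: rev_cases)
    case (snoc es D)
    then have "D (F i) = 0" using that assms(3) by (auto simp: ders_def)
    then show ?thesis using snoc that zero[of es] is_idealD(1)[OF assms(1)] by simp
  qed (use assms in simp)
  then show ?thesis by (simp add: diff_core_def)
qed

text \<open>Dropping the equations one by one gives a strictly descending chain of \<open>m + 1\<close> primes.\<close>

lemma has_alg_indep_add_le:
  assumes Q: "is_prime_ideal Q" "\<And>i. i < m \<Longrightarrow> F i \<in> Q" "G \<notin> Q" and s: "has_alg_indep s Q"
  shows "s + m \<le> CARD('n)"
proof -
  have "has_alg_indep (s + k) (diff_core (ders (m - k)) Q)" if "k \<le> m" for k
    using that
  proof (induction k)
    case 0
    then show ?case using has_alg_indep_mono[OF s diff_core_subset] by simp
  next
    case (Suc k)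
    let ?i = "m - Suc k"
    have i: "m - k = Suc ?i" "?i < m" using Suc.prems by auto
    have "diff_core (ders ?i) Q \<subseteq> diff_core (ders (m - k)) Q"
      by (intro diff_core_mono) (auto simp: ders_def)
    moreover have "F ?i \<in> diff_core (ders (m - k)) Q"
      using Q i by (intro F_in_diff_core is_prime_idealD(1)) auto
    moreover have "F ?i \<notin> diff_core (ders ?i) Q"
    proof
      \<comment> \<open>The adjugate entries \<open>A v ?i\<close> combine to a derivation that
        sends \<open>F ?i\<close> to \<open>G\<close> and the other equations to
        \<open>0\<close>.\<close>
      let ?D = "\<lambda>h. \<Sum>v\<in>C. A v ?i * mpoly_pderiv v h"
      assume "F ?i \<in> diff_core (ders ?i) Q"
      moreover have "?D \<in> ders ?i"
        using adj_right[OF i(2)] by (auto simp: ders_def derivation_mpoly_pderiv intro!: derivation_combination)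
      ultimately have "?D (F ?i) \<in> Q"
        using diff_core_stable[of ?D "ders ?i"] diff_core_subset[of "ders ?i" Q] by blast
      then show False using adj_right[OF i(2,2)] Q(3) by simp
    qed
    ultimately have "diff_core (ders ?i) Q \<subset> diff_core (ders (m - k)) Q" by blast
    then show ?case
      using has_alg_indep_psubset[OF prime_diff_core[OF Q(1)] prime_diff_core[OF Q(1)]] Suc by simp
  qed
  from this[of m] have "has_alg_indep (s + m) (diff_core (ders 0) Q)" by simp
  then show ?thesis
    using has_alg_indep_le_card is_idealD(1)[OF is_prime_idealD(1)[OF prime_diff_core[OF Q(1)]]] by blast
qed

text \<open>The direction tangent to \<open>F = 0\<close> in which the coordinate \<open>w\<close>
  moves and the other coordinates outside \<open>C\<close> rest. Cramer's rule gives its components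
  in \<open>C\<close>; the factor \<open>G\<close> clears the denominator.\<close>

lemma tangent_derivation:
  assumes "w \<notin> C"
  shows "(\<lambda>h. G * mpoly_pderiv w h - (\<Sum>v\<in>C. minor v w * mpoly_pderiv v h)) \<in> ders m"
proof -
  let ?D = "\<lambda>h. G * mpoly_pderiv w h - (\<Sum>v\<in>C. minor v w * mpoly_pderiv v h)"
  have "derivation ?D"
    by (intro derivation_diff derivation_scale derivation_combination derivation_mpoly_pderiv)
  moreover have "?D (F j) = 0" if "j < m" for j
  proof -
    have "(\<Sum>v\<in>C. minor v w * mpoly_pderiv v (F j)) =
        (\<Sum>i<m. mpoly_pderiv w (F i) * (\<Sum>v\<in>C. A v i * mpoly_pderiv v (F j)))"
      unfolding minor_def sum_distrib_left sum_distrib_right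
      by (subst sum.swap) (simp add: mult_ac)
    also have "\<dots> = (\<Sum>i<m. if i = j then G * mpoly_pderiv w (F i) else 0)"
      using that by (intro sum.cong) (auto simp: adj_right mult.commute)
    also have "\<dots> = G * mpoly_pderiv w (F j)" using that by (simp add: sum.delta)
    finally show ?thesis by simp
  qed
  ultimately show ?thesis by (auto simp: ders_def)
qed

text \<open>The coordinates outside \<open>C\<close> are independent. Tangent derivations turn a
  relation \<open>p\<close> into \<open>G\<close> times its partial derivatives. As \<open>G\<close>
  is outside the prime, these are relations of lower degree, hence zero, and in characteristic
  \<open>0\<close> the polynomial \<open>p\<close> is constant.\<close>

lemma has_alg_indep_diff_core:
  assumes Q: "is_prime_ideal Q" "G \<notin> Q"
  shows "has_alg_indep (CARD('n) - m) (diff_core (ders m) Q)"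
proof -
  let ?d = "CARD('n) - m" and ?P = "diff_core (ders m) Q"
  have P: "is_prime_ideal ?P" using prime_diff_core[OF Q(1)] .
  have GP: "G \<notin> ?P" using Q(2) diff_core_subset[of "ders m" Q] by blast
  have "card (- C) = ?d" using card_C by (simp add: Compl_eq_Diff_UNIV card_Diff_subset)
  then obtain h where h: "bij_betw h {..<?d} (- C)"
    using finite_same_card_bij[of "{..<?d}" "- C"] by auto
  define u where "u l = (if l < ?d then mvar (h l) else (0 :: ('n, 'a) mpoly))" for l
  have "p = 0" if "p \<in> vars_below ?d" "mpoly_subst u p \<in> ?P"
    "\<And>k. k \<in> Poly_Mapping.keys p \<Longrightarrow> (\<Sum>l<?d. Poly_Mapping.lookup k l) < b" for p b
    using that
  proof (induction b arbitrary: p)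
    case 0
    then have "Poly_Mapping.keys p = {}" by blast
    then show ?case by simp
  next
    case (Suc b)
    have pd: "mpoly_pderiv l p = 0" if l: "l < ?d" for l
    proof (rule Suc.IH)
      have keys: "k + Poly_Mapping.single l 1 \<in> Poly_Mapping.keys p"
        if "k \<in> Poly_Mapping.keys (mpoly_pderiv l p)" for k
        using that by (auto simp: in_keys_iff lookup_mpoly_pderiv)
      show "mpoly_pderiv l p \<in> vars_below ?d"
        unfolding vars_below_def
      proof (intro CollectI ballI subsetI)
        fix k v assume "k \<in> Poly_Mapping.keys (mpoly_pderiv l p)" "v \<in> Poly_Mapping.keys k"
        then have "k + Poly_Mapping.single l 1 \<in> Poly_Mapping.keys p"
          "v \<in> Poly_Mapping.keys (k + Poly_Mapping.single l 1)"
          using keys by (auto simp: in_keys_iff lookup_add)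
        then show "v \<in> {..<?d}" using Suc.prems(1) unfolding vars_below_def by blast
      qed
      show "(\<Sum>l<?d. Poly_Mapping.lookup k l) < b" if "k \<in> Poly_Mapping.keys (mpoly_pderiv l p)" for k
        using Suc.prems(3)[OF keys[OF that]] l
        by (simp add: lookup_add sum.distrib lookup_single when_def)
      let ?D = "\<lambda>x. G * mpoly_pderiv (h l) x - (\<Sum>v\<in>C. minor v (h l) * mpoly_pderiv v x)"
      have hC: "h l' \<notin> C" if "l' < ?d" for l'
        using bij_betw_apply[OF h] that by auto
      have D: "?D \<in> ders m" using tangent_derivation[OF hC[OF l]] .
      have Du: "?D (u l') = (if l' = l then G else 0)" for l'
      proof (cases "l' < ?d")
        case True
        then have "(\<Sum>v\<in>C. minor v (h l) * mpoly_pderiv v (u l')) = 0"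
          using hC[OF True] by (intro sum.neutral) (auto simp: u_def)
        moreover have "h l = h l' \<longleftrightarrow> l = l'"
          using bij_betw_imp_inj_on[OF h] True l by (auto simp: inj_on_def)
        ultimately show ?thesis using True l by (auto simp: u_def)
      next
        case False
        then show ?thesis using l by (auto simp: u_def derivation_zero[OF derivation_mpoly_pderiv])
      qed
      have "?D (mpoly_subst u p) = (\<Sum>v<?d. mpoly_subst u (mpoly_pderiv v p) * ?D (u v))"
        using D Du l unfolding ders_def by (intro derivation_mpoly_subst) auto
      also have "\<dots> = (\<Sum>v<?d. if v = l then mpoly_subst u (mpoly_pderiv v p) * G else 0)"
        by (intro sum.cong) (auto simp: Du)
      also have "\<dots> = mpoly_subst u (mpoly_pderiv l p) * G" using l by (simp add: sum.delta)
      finally have "mpoly_subst u (mpoly_pderiv l p) * G \<in> ?P"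
        using diff_core_stable[OF D Suc.prems(2)] by simp
      then show "mpoly_subst u (mpoly_pderiv l p) \<in> ?P"
        using is_prime_idealD(3)[OF P] GP by blast
    qed
    have "Poly_Mapping.lookup p k = 0" if "k \<noteq> 0" for k
    proof (rule ccontr)
      assume "Poly_Mapping.lookup p k \<noteq> 0"
      moreover obtain l where l: "Poly_Mapping.lookup k l \<noteq> 0"
        using \<open>k \<noteq> 0\<close> by (auto simp: poly_mapping_eq_iff fun_eq_iff)
      ultimately have "k \<in> Poly_Mapping.keys p" "l \<in> Poly_Mapping.keys k"
        by (simp_all add: in_keys_iff)
      then have "l < ?d" using Suc.prems(1) unfolding vars_below_def by blast
      have "k = k - Poly_Mapping.single l 1 + Poly_Mapping.single l 1"
        using l by (intro poly_mapping_eqI) (auto simp: lookup_add lookup_minus lookup_single when_def)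
      moreover have "Poly_Mapping.lookup (mpoly_pderiv l p) (k - Poly_Mapping.single l 1) = 0"
        using pd[OF \<open>l < ?d\<close>] by simp
      then have "Poly_Mapping.lookup p (k - Poly_Mapping.single l 1 + Poly_Mapping.single l 1) = 0"
        unfolding lookup_mpoly_pderiv by (simp del: of_nat_Suc)
      ultimately show False using \<open>Poly_Mapping.lookup p k \<noteq> 0\<close> by metis
    qed
    then have p: "p = Const (Poly_Mapping.lookup p 0)"
      by (intro poly_mapping_eqI) (auto simp: lookup_single when_def)
    then show ?case using Suc.prems(2) Const_in_prime_iff[OF P]
      by (metis mpoly_subst_simps(1) single_zero)
  qed
  moreover have "\<exists>b. \<forall>k\<in>Poly_Mapping.keys p. (\<Sum>l<?d. Poly_Mapping.lookup k l) < b" for p :: "(nat, 'a) mpoly"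
    using finite_nat_set_iff_bounded[of "(\<lambda>k. \<Sum>l<?d. Poly_Mapping.lookup k l) ` Poly_Mapping.keys p"] by auto
  ultimately show ?thesis unfolding has_alg_indep_def by meson
qed

text \<open>All the primes \<open>diff_core (ders m) P\<close>, \<open>diff_core (ders m) Q\<close> and the minimal prime of
  \<open>J\<close> below \<open>Q\<close> have transcendence degree \<open>d\<close> and are contained in the second one, so they
  coincide.\<close>

lemma ideal_subset_smaller_prime:
  assumes P: "is_prime_ideal P" and Q: "is_prime_ideal Q" and "P \<subseteq> Q" "G \<notin> Q"
    and FP: "\<And>i. i < m \<Longrightarrow> F i \<in> P"
    and J: "J \<subseteq> Q" "\<And>i. i < m \<Longrightarrow> F i \<in> J" "pure_dim J d" and d: "d + m = CARD('n)"
  shows "J \<subseteq> P"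
proof -
  let ?c = "diff_core (ders m)"
  obtain M where M: "is_minimal_prime J M" "M \<subseteq> Q"
    using exists_minimal_prime[OF Q J(1)] by blast
  then have primeM: "is_prime_ideal M" "J \<subseteq> M" by (auto simp: is_minimal_prime_def)
  have indM: "has_alg_indep d M"
    using has_alg_indep_quotient_dim[OF primeM(1)] J(3) M(1) by (auto simp: pure_dim_def)
  have FM: "F i \<in> M" if "i < m" for i using J(2)[OF that] primeM(2) by blast
  have d': "d = CARD('n) - m" using d by simp
  \<comment> \<open>A strict inclusion would provide \<open>d + 1\<close> independent elements
    modulo \<open>P1\<close>, too many beside \<open>m\<close> equations in \<open>d + m\<close>
    variables.\<close>
  have eq: "P1 = P2"
    if "is_prime_ideal P1" "is_prime_ideal P2" "P1 \<subseteq> P2" "G \<notin> P2" "has_alg_indep d P2"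
      "\<And>i. i < m \<Longrightarrow> F i \<in> P1" for P1 P2
  proof (rule ccontr)
    assume "P1 \<noteq> P2"
    then have "has_alg_indep (Suc d) P1" using that by (intro has_alg_indep_psubset) auto
    moreover have "G \<notin> P1" using that by blast
    ultimately have "Suc d + m \<le> CARD('n)" using that by (intro has_alg_indep_add_le) auto
    then show False using d by simp
  qed
  have c: "is_prime_ideal (?c R)" "G \<notin> ?c R" "has_alg_indep d (?c R)"
    if "is_prime_ideal R" "G \<notin> R" for R
    using that prime_diff_core has_alg_indep_diff_core d' diff_core_subset[of "ders m" R] by auto
  have FC: "F i \<in> ?c R" if "is_prime_ideal R" "F i \<in> R" "i < m" for i R
    using that by (intro F_in_diff_core is_prime_idealD(1)) auto
  have G: "G \<notin> P" "G \<notin> M" using assms(3,4) M(2) by auto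
  have "?c M = M"
    
    using c[OF primeM(1) G(2)] primeM G(2) indM FC[OF primeM(1) FM] FM
    by (intro eq diff_core_subset)
  moreover have "?c M = ?c Q"
    using c[OF primeM(1) G(2)] c[OF Q assms(4)] FC FM primeM M(2)
    by (intro eq diff_core_mono) auto
  moreover have "?c P = ?c Q"
    using c[OF P G(1)] c[OF Q assms(4)] FC FP P assms(3)
    by (intro eq diff_core_mono) auto
  \<comment> \<open>The chain is
    \<open>J \<subseteq> M = ?c M = ?c Q = ?c P \<subseteq> P\<close>.\<close>
  ultimately show ?thesis using primeM(2) diff_core_subset[of "ders m" P] by auto
qed

end

text \<open>Guarantees that the truncated subtraction \<open>CARD('n) - d\<close>, the size of the
  minors, is a true one as soon as some prime contains \<open>J\<close>.\<close>

lemma pure_dim_le_card: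
  fixes J :: "('n::finite, 'a::field) mpoly set"
  assumes "pure_dim J d" "is_prime_ideal P" "J \<subseteq> P"
  shows "d \<le> CARD('n)"
proof -
  obtain M where M: "is_minimal_prime J M" using exists_minimal_prime[OF assms(2,3)] by blast
  then have "is_prime_ideal M" by (simp add: is_minimal_prime_def)
  then show ?thesis
    using has_alg_indep_quotient_dim[of M d] has_alg_indep_le_card[of M d] assms(1) M
      is_idealD(1)[OF is_prime_idealD(1)] by (auto simp: pure_dim_def)
qed

section \<open>Lifting arcs\<close>

lemma fps_X_power_times_shift:
  fixes f :: "'a::comm_ring_1 fps"
  assumes "\<And>i. i < k \<Longrightarrow> fps_nth f i = 0"
  shows "fps_X ^ k * fps_shift k f = f"
  using assms by (intro fps_ext) (simp add: fps_X_power_mult_nth)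

lemma fps_X_power_dvd_iff:
  fixes f :: "'a::comm_ring_1 fps"
  shows "fps_X ^ k dvd f \<longleftrightarrow> (\<forall>i<k. fps_nth f i = 0)"
proof
  assume "fps_X ^ k dvd f"
  then show "\<forall>i<k. fps_nth f i = 0" by (auto simp: dvd_def fps_X_power_mult_nth)
qed (metis dvd_triv_left fps_X_power_times_shift)

lemma fps_shift_X_power_times: "fps_shift k (fps_X ^ k * (f :: 'a::comm_ring_1 fps)) = f"
  by (intro fps_ext) (simp add: fps_X_power_mult_nth)

lemma fps_shift_diff: "fps_shift k (f - g) = fps_shift k f - fps_shift k (g :: 'a::comm_ring_1 fps)"
  by (intro fps_ext) simp

lemma fps_X_power_dvd_shift:
  "fps_X ^ (j + k) dvd f \<Longrightarrow> fps_X ^ j dvd fps_shift k (f :: 'a::comm_ring_1 fps)"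
  by (auto simp: fps_X_power_dvd_iff)

lemma fps_X_power_dvd_mono:
  "j \<le> k \<Longrightarrow> fps_X ^ k dvd f \<Longrightarrow> fps_X ^ j dvd (f :: 'a::comm_ring_1 fps)"
  by (auto simp: fps_X_power_dvd_iff)

lemma fps_eq_0_if_dvd:
  "(\<And>k. fps_X ^ k dvd f) \<Longrightarrow> f = (0 :: 'a::comm_ring_1 fps)"
  by (intro fps_ext) (auto simp: fps_X_power_dvd_iff)

locale arc_lifting = jacobian_minor F m C A G
  for F :: "nat \<Rightarrow> ('n::finite, 'a::field_char_0) mpoly" and m C A G +
  fixes e e' :: nat
  assumes e'_le: "e' \<le> e"
begin

definition nondegenerate :: "('n \<Rightarrow> 'a fps) \<Rightarrow> bool" where
  "nondegenerate a \<longleftrightarrow> fps_X ^ e' dvd arc_eval a G \<and> fps_nth (arc_eval a G) e' \<noteq> 0 \<and>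
     (\<forall>v\<in>C. \<forall>w. fps_X ^ e' dvd arc_eval a (minor v w))"

definition same_jet :: "('n \<Rightarrow> 'a fps) \<Rightarrow> ('n \<Rightarrow> 'a fps) \<Rightarrow> bool" where
  "same_jet a b \<longleftrightarrow> (\<forall>v. fps_X ^ (e + 1) dvd a v - b v)"

definition corrections :: "('n \<Rightarrow> 'a fps) set" where
  "corrections = {y. (\<forall>v. fps_X ^ (e + 1) dvd y v) \<and> (\<forall>v. v \<notin> C \<longrightarrow> y v = 0)}"

text \<open>The adjugate stays evaluated at \<open>a\<close> while the equations are evaluated at
  \<open>a + y\<close>, so the linear part in \<open>y\<close> has the fixed coefficients
  \<open>minor v w\<close>.\<close>

definition defect :: "('n \<Rightarrow> 'a fps) \<Rightarrow> ('n \<Rightarrow> 'a fps) \<Rightarrow> 'n \<Rightarrow> 'a fps" where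
  "defect a y v = (\<Sum>i<m. arc_eval a (A v i) * arc_eval (\<lambda>w. a w + y w) (F i))"

text \<open>The order \<open>e + e' + 1\<close> is what a correction in \<open>(t^(e+1))\<close> can
  compensate, since the linear part contributes a further \<open>t^e'\<close>.\<close>

definition liftable :: "('n \<Rightarrow> 'a fps) \<Rightarrow> bool" where
  "liftable a \<longleftrightarrow> (\<forall>v\<in>C. fps_X ^ (e + e' + 1) dvd defect a (\<lambda>_. 0) v)"

text \<open>The derivative is kept fixed at \<open>a\<close>. The quotient by \<open>arc_eval a G\<close>, which has order \<open>e'\<close>,
  is written as a shift followed by the inverse of a unit, so that it makes sense for all \<open>a\<close>.\<close>

definition newton :: "('n \<Rightarrow> 'a fps) \<Rightarrow> ('n \<Rightarrow> 'a fps) \<Rightarrow> 'n \<Rightarrow> 'a fps" where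
  "newton a y v =
     (if v \<in> C then y v - inverse (fps_shift e' (arc_eval a G)) * fps_shift e' (defect a y v) else 0)"

definition approx :: "('n \<Rightarrow> 'a fps) \<Rightarrow> nat \<Rightarrow> 'n \<Rightarrow> 'a fps" where
  "approx a k = (newton a ^^ k) (\<lambda>_. 0)"

text \<open>The coefficient \<open>j\<close> of the iterates does not change from step \<open>j + 1\<close> on.\<close>

definition correction :: "('n \<Rightarrow> 'a fps) \<Rightarrow> 'n \<Rightarrow> 'a fps" where
  "correction a v = Abs_fps (\<lambda>j. fps_nth (approx a (Suc j) v) j)"

definition lift :: "('n \<Rightarrow> 'a fps) \<Rightarrow> 'n \<Rightarrow> 'a fps" where
  "lift a v = a v + correction a v"

lemma same_jet_iff: "same_jet a b \<longleftrightarrow> (\<forall>v. \<forall>i\<le>e. fps_nth (a v) i = fps_nth (b v) i)"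
  by (auto simp: same_jet_def fps_X_power_dvd_iff less_Suc_eq_le simp del: power_Suc)

lemma same_jet_sym: "same_jet a b \<Longrightarrow> same_jet b a"
  by (simp add: same_jet_iff)

lemma same_jet_trans: "same_jet a b \<Longrightarrow> same_jet b c \<Longrightarrow> same_jet a c"
  by (simp add: same_jet_iff)

lemma nondegenerate_cong:
  assumes "nondegenerate a" "same_jet a b"
  shows "nondegenerate b"
proof -
  have eq: "fps_nth (arc_eval a h) i = fps_nth (arc_eval b h) i" if "i \<le> e" for h i
    using arc_eval_cong_dvd[of "fps_X ^ (e + 1)" a b h] assms(2) that
    by (auto simp: same_jet_def fps_X_power_dvd_iff simp del: power_Suc)
  have "fps_X ^ e' dvd arc_eval a h \<longleftrightarrow> fps_X ^ e' dvd arc_eval b h" for h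
    using eq e'_le by (auto simp: fps_X_power_dvd_iff)
  then show ?thesis using assms(1) eq[OF e'_le] by (auto simp: nondegenerate_def)
qed

lemma G_factor:
  assumes "nondegenerate a"
  shows "arc_eval a G = fps_X ^ e' * fps_shift e' (arc_eval a G)"
    "inverse (fps_shift e' (arc_eval a G)) * fps_shift e' (arc_eval a G) = 1"
    "arc_eval a G \<noteq> 0"
  using assms
  by (auto simp: nondegenerate_def fps_X_power_dvd_iff fps_X_power_times_shift intro!: inverse_mult_eq_1)

text \<open>Taylor expansion of each \<open>F i\<close> with the moduli \<open>t^(e+1)\<close> and
  \<open>t^k\<close>, combined with the adjugate. All coordinates may move here; for corrections in
  \<open>C\<close> only the diagonal term with \<open>G\<close> survives.\<close>

lemma defect_diff_general:
  assumes y: "\<And>v. fps_X ^ (e + 1) dvd y v" and z: "\<And>v. fps_X ^ (e + 1) dvd z v"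
    and k: "\<And>v. fps_X ^ k dvd y v - z v"
  shows "fps_X ^ (e + 1 + k) dvd defect a y v - defect a z v
    - (\<Sum>w\<in>UNIV. arc_eval a (minor v w) * (y w - z w))"
proof -
  let ?t = "\<lambda>i. arc_eval (\<lambda>w. a w + y w) (F i) - arc_eval (\<lambda>w. a w + z w) (F i)
    - (\<Sum>w\<in>UNIV. arc_eval a (mpoly_pderiv w (F i)) * (y w - z w))"
  have "(\<Sum>w\<in>UNIV. arc_eval a (minor v w) * (y w - z w)) =
      (\<Sum>i<m. arc_eval a (A v i) * (\<Sum>w\<in>UNIV. arc_eval a (mpoly_pderiv w (F i)) * (y w - z w)))"
    unfolding minor_def arc.hom_sum arc.hom_mult sum_distrib_left sum_distrib_right
    by (subst sum.swap) (simp add: mult.assoc)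
  then have "defect a y v - defect a z v - (\<Sum>w\<in>UNIV. arc_eval a (minor v w) * (y w - z w)) =
      (\<Sum>i<m. arc_eval a (A v i) * ?t i)"
    by (simp only: defect_def right_diff_distrib sum_subtractf)
  also have "fps_X ^ (e + 1) * fps_X ^ k dvd \<dots>"
    using y z k by (intro dvd_sum dvd_mult arc_eval_taylor)
  finally show ?thesis by (simp only: power_add)
qed

lemma defect_diff:
  assumes y: "y \<in> corrections" and z: "z \<in> corrections" and k: "\<And>v. fps_X ^ k dvd y v - z v"
    and v: "v \<in> C"
  shows "fps_X ^ (e + 1 + k) dvd defect a y v - defect a z v - arc_eval a G * (y v - z v)"
proof -
  have "(\<Sum>w\<in>UNIV. arc_eval a (minor v w) * (y w - z w)) =
      (\<Sum>w\<in>UNIV. if w = v then arc_eval a G * (y w - z w) else 0)"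
  proof (intro sum.cong refl)
    fix w
    show "arc_eval a (minor v w) * (y w - z w) = (if w = v then arc_eval a G * (y w - z w) else 0)"
      using y z adj_left[OF v, of w] v unfolding corrections_def minor_def
      by (cases "w \<in> C") (auto simp: arc.hom_zero)
  qed
  also have "\<dots> = arc_eval a G * (y v - z v)" by (simp add: sum.delta)
  finally show ?thesis
    using defect_diff_general[of y z k a v] y z k by (simp add: corrections_def)
qed

lemma zero_corrections: "(\<lambda>_. 0) \<in> corrections"
  by (simp add: corrections_def)

lemma defect_dvd:
  assumes "nondegenerate a" "liftable a" "y \<in> corrections" "v \<in> C"
  shows "fps_X ^ (e + e' + 1) dvd defect a y v"
proof -
  have X: "fps_X ^ (e + 1) dvd y v" using assms(3) by (simp add: corrections_def)
  have "fps_X ^ (e + 1 + (e + 1)) dvd defect a y v - defect a (\<lambda>_. 0) v - arc_eval a G * (y v - 0)"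
    using assms(3,4) zero_corrections by (intro defect_diff) (auto simp: corrections_def)
  then have "fps_X ^ (e + e' + 1) dvd defect a y v - defect a (\<lambda>_. 0) v - arc_eval a G * (y v - 0)"
    by (rule fps_X_power_dvd_mono[rotated]) (use e'_le in simp)
  moreover have "fps_X ^ (e + e' + 1) dvd arc_eval a G * (y v - 0)"
    using mult_dvd_mono[of "fps_X ^ e'" "arc_eval a G" "fps_X ^ (e + 1)" "y v"] assms(1) X
    by (simp add: nondegenerate_def power_add mult_ac)
  moreover have "fps_X ^ (e + e' + 1) dvd defect a (\<lambda>_. 0) v" using assms by (simp add: liftable_def)
  ultimately show ?thesis by (auto simp: fps_X_power_dvd_iff simp del: power_Suc)
qed

lemma newton_corrections:
  assumes "nondegenerate a" "liftable a" "y \<in> corrections"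
  shows "newton a y \<in> corrections"
proof -
  have "fps_X ^ (e + 1) dvd newton a y v" if "v \<in> C" for v
  proof -
    have "fps_X ^ (e + 1 + e') dvd defect a y v"
      using defect_dvd[OF assms that] by (simp add: add_ac del: power_Suc)
    then have "fps_X ^ (e + 1) dvd fps_shift e' (defect a y v)" by (rule fps_X_power_dvd_shift)
    moreover have "fps_X ^ (e + 1) dvd y v" using assms(3) by (simp add: corrections_def)
    ultimately show ?thesis using that by (simp add: newton_def dvd_diff del: power_Suc)
  qed
  then show ?thesis unfolding corrections_def by (auto simp: newton_def)
qed

text \<open>The step cancels exactly the linear part of the change of the defect. What remains has
  order at least \<open>e + 1 + k\<close>, and the shift by \<open>e' \<le> e\<close> leaves at
  least \<open>k + 1\<close>.\<close>

lemma newton_contraction: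
  assumes a: "nondegenerate a" and y: "y \<in> corrections" and z: "z \<in> corrections"
    and k: "\<And>v. fps_X ^ k dvd y v - z v"
  shows "fps_X ^ Suc k dvd newton a y v - newton a z v"
proof (cases "v \<in> C")
  case True
  let ?u = "fps_shift e' (arc_eval a G)"
  define r where "r = defect a y v - defect a z v - arc_eval a G * (y v - z v)"
  have r: "fps_X ^ (e + 1 + k) dvd r"
    unfolding r_def using y z k True by (rule defect_diff)
  have "fps_shift e' (defect a y v) - fps_shift e' (defect a z v) =
      fps_shift e' (r + fps_X ^ e' * (?u * (y v - z v)))"
    unfolding r_def using G_factor(1)[OF a] by (simp add: mult.assoc[symmetric] fps_shift_diff)
  also have "\<dots> = fps_shift e' r + ?u * (y v - z v)"
    unfolding fps_shift_add fps_shift_X_power_times ..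
  finally have eq: "fps_shift e' (defect a y v) - fps_shift e' (defect a z v) =
      fps_shift e' r + ?u * (y v - z v)" .
  have "newton a y v - newton a z v = (y v - z v) -
      inverse ?u * (fps_shift e' (defect a y v) - fps_shift e' (defect a z v))"
    using True by (simp add: newton_def right_diff_distrib)
  also have "\<dots> = (y v - z v) - (inverse ?u * fps_shift e' r + (inverse ?u * ?u) * (y v - z v))"
    unfolding eq by (simp only: distrib_left mult.assoc)
  also have "\<dots> = - (inverse ?u * fps_shift e' r)"
    unfolding G_factor(2)[OF a] by simp
  finally show ?thesis
    using fps_X_power_dvd_shift[of "Suc k" e' r] fps_X_power_dvd_mono[of "Suc k + e'" "e + 1 + k" r] r e'_le
    by (auto intro: dvd_mult)
qed (simp add: newton_def)

section \<open>The limit of the Newton iteration\<close>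

context
  fixes a assumes a: "nondegenerate a" "liftable a"
begin

lemma approx_corrections: "approx a k \<in> corrections"
  by (induction k) (auto simp: approx_def zero_corrections intro: newton_corrections[OF a])

lemma approx_Suc: "fps_X ^ k dvd approx a (Suc k) v - approx a k v"
proof (induction k arbitrary: v)
  case (Suc k)
  have "fps_X ^ Suc k dvd newton a (approx a (Suc k)) v - newton a (approx a k) v"
    by (rule newton_contraction[OF a(1) approx_corrections approx_corrections Suc.IH])
  then show ?case by (simp add: approx_def)
qed simp

lemma approx_le: "k \<le> l \<Longrightarrow> fps_X ^ k dvd approx a l v - approx a k v"
proof (induction l rule: dec_induct)
  case (step l)
  have "fps_X ^ k dvd approx a (Suc l) v - approx a l v"
    using approx_Suc[of l v] step(1) by (rule fps_X_power_dvd_mono[rotated])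
  then show ?case using step.IH by (auto simp: fps_X_power_dvd_iff)
qed simp

lemma correction_approx: "fps_X ^ k dvd correction a v - approx a k v"
  unfolding fps_X_power_dvd_iff
proof (intro allI impI)
  fix j assume "j < k"
  then show "fps_nth (correction a v - approx a k v) j = 0"
    using approx_le[of "Suc j" k v]
    by (auto simp: correction_def fps_X_power_dvd_iff simp del: power_Suc)
qed

lemma correction_corrections: "correction a \<in> corrections"
  unfolding corrections_def
proof (intro CollectI conjI allI impI)
  fix v
  show "fps_X ^ (e + 1) dvd correction a v"
    unfolding fps_X_power_dvd_iff
  proof (intro allI impI)
    fix i assume "i < e + 1"
    then show "fps_nth (correction a v) i = 0"
      using approx_corrections[of "Suc i"]
      by (auto simp: corrections_def correction_def fps_X_power_dvd_iff simp del: power_Suc)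
  qed
  show "correction a v = 0" if "v \<notin> C"
    using approx_corrections that by (intro fps_ext) (simp add: corrections_def correction_def)
qed

lemma newton_correction: "newton a (correction a) = correction a"
proof
  fix v
  have "newton a (correction a) v - correction a v = 0"
  proof (rule fps_eq_0_if_dvd)
    fix k
    have "fps_X ^ Suc k dvd newton a (correction a) v - newton a (approx a k) v"
      by (rule newton_contraction[OF a(1) correction_corrections approx_corrections correction_approx])
    then have "fps_X ^ Suc k dvd newton a (correction a) v - approx a (Suc k) v"
      by (simp add: approx_def)
    then have "fps_X ^ Suc k dvd
        (newton a (correction a) v - approx a (Suc k) v) - (correction a v - approx a (Suc k) v)"
      using correction_approx by (rule dvd_diff)
    then have "fps_X ^ Suc k dvd newton a (correction a) v - correction a v" by simp
    then show "fps_X ^ k dvd newton a (correction a) v - correction a v"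
      by (rule fps_X_power_dvd_mono[rotated]) simp
  qed
  then show "newton a (correction a) v = correction a v" by simp
qed

lemma lift_same_jet: "same_jet (lift a) a"
  using correction_corrections by (simp add: same_jet_def lift_def corrections_def)

lemma lift_outside: "v \<notin> C \<Longrightarrow> lift a v = a v"
  using correction_corrections by (simp add: lift_def corrections_def)

lemma arc_eval_lift:
  assumes "j < m"
  shows "arc_eval (lift a) (F j) = 0"
proof -
  let ?y = "correction a" and ?u = "fps_shift e' (arc_eval a G)"
  have 0: "defect a ?y v = 0" if v: "v \<in> C" for v
  proof -
    have "inverse ?u * fps_shift e' (defect a ?y v) = 0"
      using fun_cong[OF newton_correction, of v] v by (simp add: newton_def)
    moreover have "inverse ?u \<noteq> 0" using G_factor(2)[OF a(1)] by (metis mult_zero_left zero_neq_one)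
    ultimately have "fps_shift e' (defect a ?y v) = 0" by (simp add: mult_eq_0_iff)
    then show ?thesis
      using defect_dvd[OF a correction_corrections v] fps_X_power_times_shift[of e' "defect a ?y v"]
      by (simp add: fps_X_power_dvd_iff del: power_Suc)
  qed
  \<comment> \<open>Multiplying the vanishing defect by the Jacobian matrix at \<open>a\<close>
    turns the adjugate into the scalar \<open>G\<close>, which is nonzero along
    \<open>a\<close>.\<close>
  have "0 = (\<Sum>v\<in>C. arc_eval a (mpoly_pderiv v (F j)) * defect a ?y v)" by (simp add: 0)
  also have "\<dots> = (\<Sum>i<m. arc_eval a (\<Sum>v\<in>C. A v i * mpoly_pderiv v (F j)) *
      arc_eval (lift a) (F i))"
    unfolding defect_def sum_distrib_left arc.hom_sum arc.hom_mult sum_distrib_right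
    by (subst sum.swap) (simp add: mult_ac lift_def[abs_def])
  also have "\<dots> = (\<Sum>i<m. if i = j then arc_eval a G * arc_eval (lift a) (F i) else 0)"
    using assms by (intro sum.cong) (auto simp: adj_right arc.hom_zero)
  also have "\<dots> = arc_eval a G * arc_eval (lift a) (F j)" using assms by (simp add: sum.delta)
  finally show ?thesis using G_factor(3)[OF a(1)] by simp
qed

end

section \<open>Uniqueness of the lift and necessity of its solvability condition\<close>

lemma defect_eq_0:
  "(\<And>i. i < m \<Longrightarrow> arc_eval (\<lambda>w. a w + y w) (F i) = 0) \<Longrightarrow> defect a y v = 0"
  by (simp add: defect_def)

text \<open>For the difference \<open>y\<close> of two solutions both defects vanish, so
  \<open>G * y\<close> is divisible by \<open>t^(e+1+k)\<close> whenever \<open>y\<close> is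
  divisible by \<open>t^k\<close>. Cancelling \<open>G\<close> costs only \<open>e' \<le> e\<close>,
  and the order of \<open>y\<close> increases.\<close>

lemma arc_unique:
  assumes a: "nondegenerate a" and ab: "same_jet a b" "\<And>v. v \<notin> C \<Longrightarrow> a v = b v"
    and F: "\<And>i. i < m \<Longrightarrow> arc_eval a (F i) = 0" "\<And>i. i < m \<Longrightarrow> arc_eval b (F i) = 0"
  shows "a = b"
proof -
  define y where "y v = b v - a v" for v
  have y: "y \<in> corrections"
    using same_jet_sym[OF ab(1)] ab(2) by (auto simp: corrections_def y_def same_jet_def)
  have d: "defect a y v = 0" "defect a (\<lambda>_. 0) v = 0" for v
    using F by (auto intro!: defect_eq_0 simp: y_def)
  have "fps_X ^ k dvd y v" for k v
  proof (induction k arbitrary: v)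
    case (Suc k)
    show ?case
    proof (cases "v \<in> C")
      case True
      have "fps_X ^ (e + 1 + k) dvd defect a y v - defect a (\<lambda>_. 0) v - arc_eval a G * (y v - 0)"
        using y True zero_corrections Suc by (intro defect_diff) auto
      then have "fps_X ^ (e + 1 + k) dvd arc_eval a G * y v" by (simp add: d)
      then have "fps_X ^ (Suc k + e') dvd arc_eval a G * y v"
        by (rule fps_X_power_dvd_mono[rotated]) (use e'_le in simp)
      then have "fps_X ^ Suc k dvd fps_shift e' (arc_eval a G * y v)"
        by (rule fps_X_power_dvd_shift)
      also have "fps_shift e' (arc_eval a G * y v) = fps_shift e' (arc_eval a G) * y v"
        by (subst G_factor(1)[OF a]) (simp only: mult.assoc fps_shift_X_power_times)
      finally have "fps_X ^ Suc k dvd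
          inverse (fps_shift e' (arc_eval a G)) * (fps_shift e' (arc_eval a G) * y v)"
        by (rule dvd_mult)
      then show ?thesis unfolding mult.assoc[symmetric] G_factor(2)[OF a] by simp
    qed (use y in \<open>simp add: corrections_def\<close>)
  qed simp
  then have "y v = 0" for v by (intro fps_eq_0_if_dvd)
  then show ?thesis by (auto simp: y_def)
qed

text \<open>The two arcs may differ in every coordinate, so the linear part involves minors with
  columns outside \<open>C\<close>. Their divisibility by \<open>t^e'\<close> keeps it in
  \<open>(t^(e+e'+1))\<close>.\<close>

lemma liftable_if_arc:
  assumes a: "nondegenerate a" and ab: "same_jet a b"
    and F: "\<And>i. i < m \<Longrightarrow> arc_eval b (F i) = 0"
  shows "liftable a"
  unfolding liftable_def
proof
  fix v assume v: "v \<in> C"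
  define y where "y v = b v - a v" for v
  have y: "fps_X ^ (e + 1) dvd y w" for w
    using same_jet_sym[OF ab(1)] by (auto simp: y_def same_jet_def)
  have d: "defect a y v = 0" using F by (auto intro!: defect_eq_0 simp: y_def)
  have "fps_X ^ (e + 1 + (e + 1)) dvd
      defect a y v - defect a (\<lambda>_. 0) v - (\<Sum>w\<in>UNIV. arc_eval a (minor v w) * (y w - 0))"
    using y by (intro defect_diff_general) auto
  then have "fps_X ^ (e + e' + 1) dvd
      defect a y v - defect a (\<lambda>_. 0) v - (\<Sum>w\<in>UNIV. arc_eval a (minor v w) * (y w - 0))"
    by (rule fps_X_power_dvd_mono[rotated]) (use e'_le in simp)
  moreover have "fps_X ^ (e + e' + 1) dvd (\<Sum>w\<in>UNIV. arc_eval a (minor v w) * (y w - 0))"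
  proof (rule dvd_sum)
    fix w
    show "fps_X ^ (e + e' + 1) dvd arc_eval a (minor v w) * (y w - 0)"
      using mult_dvd_mono[of "fps_X ^ e'" "arc_eval a (minor v w)" "fps_X ^ (e + 1)" "y w"] a y v
      by (simp add: nondegenerate_def power_add mult_ac)
  qed
  ultimately have "fps_X ^ (e + e' + 1) dvd defect a y v - defect a (\<lambda>_. 0) v"
    by (auto simp: fps_X_power_dvd_iff simp del: power_Suc)
  then show "fps_X ^ (e + e' + 1) dvd defect a (\<lambda>_. 0) v" by (simp add: d)
qed

end

section \<open>Arcs depending on parameters\<close>

text \<open>Abstracts polynomial dependence on a parameter \<open>p\<close>. The instances are
  polynomials in one line parameter, restrictions of polynomials in given coordinates, and
  polynomials divided by powers of \<open>H\<close>.\<close>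

locale function_ring =
  fixes R :: "('p \<Rightarrow> 'a::field_char_0) set"
  assumes const: "(\<lambda>_. c) \<in> R"
    and add: "g \<in> R \<Longrightarrow> h \<in> R \<Longrightarrow> (\<lambda>p. g p + h p) \<in> R"
    and mult: "g \<in> R \<Longrightarrow> h \<in> R \<Longrightarrow> (\<lambda>p. g p * h p) \<in> R"
begin

lemma uminus: "g \<in> R \<Longrightarrow> (\<lambda>p. - g p) \<in> R"
  using mult[OF const[of "- 1"], of g] by simp

lemma sum: "(\<And>i. i \<in> I \<Longrightarrow> g i \<in> R) \<Longrightarrow> (\<lambda>p. \<Sum>i\<in>I. g i p) \<in> R"
  by (induction I rule: infinite_finite_induct) (auto intro: const add)

definition family :: "('p \<Rightarrow> 'a fps) \<Rightarrow> bool" where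
  "family g \<longleftrightarrow> (\<forall>j. (\<lambda>p. fps_nth (g p) j) \<in> R)"

lemma family_const: "family (\<lambda>_. c)"
  by (auto simp: family_def const)

lemma family_add: "family g \<Longrightarrow> family h \<Longrightarrow> family (\<lambda>p. g p + h p)"
  by (auto simp: family_def add)

lemma family_uminus: "family g \<Longrightarrow> family (\<lambda>p. - g p)"
  by (auto simp: family_def uminus)

lemma family_diff: "family g \<Longrightarrow> family h \<Longrightarrow> family (\<lambda>p. g p - h p)"
  using family_add[of g "\<lambda>p. - h p"] by (simp add: family_uminus)

lemma family_mult: "family g \<Longrightarrow> family h \<Longrightarrow> family (\<lambda>p. g p * h p)"
  by (auto simp: family_def fps_mult_nth intro!: sum mult)

lemma family_sum: "(\<And>i. i \<in> I \<Longrightarrow> family (g i)) \<Longrightarrow> family (\<lambda>p. \<Sum>i\<in>I. g i p)"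
  by (induction I rule: infinite_finite_induct) (auto intro: family_const family_add)

lemma family_shift: "family g \<Longrightarrow> family (\<lambda>p. fps_shift k (g p))"
  by (auto simp: family_def)

lemma family_inverse:
  assumes g: "family g" and 0: "(\<lambda>p. inverse (fps_nth (g p) 0)) \<in> R"
  shows "family (\<lambda>p. inverse (g p))"
proof -
  have "(\<lambda>p. natfun_inverse (g p) j) \<in> R" for j
  proof (induction j rule: less_induct)
    case (less j)
    show ?case
    proof (cases j)
      case (Suc k)
      have "(\<lambda>p. - inverse (fps_nth (g p) 0) *
          (\<Sum>i = 1..Suc k. fps_nth (g p) i * natfun_inverse (g p) (Suc k - i))) \<in> R"
        using g less Suc by (intro mult uminus sum 0) (auto simp: family_def)
      then show ?thesis unfolding Suc fps_right_inverse_constructor.simps .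
    qed (use 0 in simp)
  qed
  then show ?thesis by (simp add: family_def fps_inverse_def)
qed

lemma family_arc_eval:
  assumes "\<And>v. family (\<lambda>p. a p v)"
  shows "family (\<lambda>p. arc_eval (a p) h)"
proof (induction h rule: mpoly_induct)
  case (add f g)
  then show ?case by (simp add: arc.hom_add family_add)
next
  case (mult f g)
  then show ?case by (simp add: arc.hom_mult family_mult)
qed (use assms in \<open>simp_all add: family_const\<close>)

text \<open>Each coefficient of \<open>lift\<close> is reached after finitely many Newton steps, and
  the only division is by the coefficient \<open>e'\<close> of \<open>G\<close>. This yields the
  prime on the line, the equations of the strata and the textile inverse.\<close>

lemma family_lift:
  assumes "arc_lifting F m C A G e e'" and a: "\<And>v. family (\<lambda>p. a p v)"
    and G: "(\<lambda>p. inverse (fps_nth (arc_eval (a p) G) e')) \<in> R"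
  shows "family (\<lambda>p. arc_lifting.lift F m C A G e' (a p) v)"
proof -
  interpret arc_lifting F m C A G e e' by fact
  have newton: "family (\<lambda>p. newton (a p) (y p) v)" if y: "\<And>v. family (\<lambda>p. y p v)" for y v
  proof (cases "v \<in> C")
    case True
    have "family (\<lambda>p. inverse (fps_shift e' (arc_eval (a p) G)))"
      using G by (intro family_inverse family_shift family_arc_eval a) simp
    then show ?thesis unfolding newton_def defect_def using True
      by (auto intro!: family_diff family_mult family_shift family_sum family_arc_eval family_add a y)
  qed (simp add: newton_def family_const)
  have "family (\<lambda>p. approx (a p) k v)" for k v
    by (induction k arbitrary: v) (auto simp: approx_def family_const intro: newton)
  then have "family (\<lambda>p. correction (a p) v)"
    by (simp add: family_def correction_def)
  then show ?thesis unfolding lift_def by (intro family_add a)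
qed

end

lemma function_ring_poly: "function_ring {g :: 'a::field_char_0 \<Rightarrow> 'a. \<exists>q. \<forall>x. g x = poly q x}"
proof
  show "(\<lambda>_. c) \<in> {g :: 'a \<Rightarrow> 'a. \<exists>q. \<forall>x. g x = poly q x}" for c
    by (auto intro: exI[of _ "[:c:]"])
  fix g h :: "'a \<Rightarrow> 'a"
  assume "g \<in> {g. \<exists>q. \<forall>x. g x = poly q x}" "h \<in> {g. \<exists>q. \<forall>x. g x = poly q x}"
  then obtain q r where "\<forall>x. g x = poly q x" "\<forall>x. h x = poly r x" by auto
  then have "\<forall>x. g x + h x = poly (q + r) x" "\<forall>x. g x * h x = poly (q * r) x" by simp_all
  then show "(\<lambda>x. g x + h x) \<in> {g. \<exists>q. \<forall>x. g x = poly q x}"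
    "(\<lambda>x. g x * h x) \<in> {g. \<exists>q. \<forall>x. g x = poly q x}" by blast+
qed

subsection \<open>Arcs over the jet of an arc of the variety\<close>

lemma is_prime_ideal_arc_kernel:
  fixes a :: "'n \<Rightarrow> 'a::field fps"
  shows "is_prime_ideal {h. arc_eval a h = 0}"
  by (auto simp: is_prime_ideal_def is_ideal_iff arc.hom_add arc.hom_mult arc.hom_zero arc.hom_one)

text \<open>The arcs with the equations \<open>F\<close> over a jet form an affine space. On the line through
  \<open>a\<close> and \<open>b\<close> in it, the polynomials that vanish at all points form a prime ideal.\<close>

lemma (in arc_lifting) vanish_on_same_jet:
  assumes Fa: "\<And>i. i < m \<Longrightarrow> arc_eval a (F i) = 0" and b: "nondegenerate b" "same_jet a b"
    and J: "\<And>h. h \<in> J \<Longrightarrow> arc_eval b h = 0" "\<And>i. i < m \<Longrightarrow> F i \<in> J" "pure_dim J d"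
    and d: "d + m = CARD('n)" and h: "h \<in> J"
  shows "arc_eval a h = 0"
proof -
  \<comment> \<open>Only the coordinates outside \<open>C\<close> are interpolated; those in
    \<open>C\<close> are recomputed by \<open>lift\<close>, so that the line runs inside the
    solutions of \<open>F\<close>.\<close>
  define c where "c l v = (if v \<in> C then b v else b v + fps_const l * (a v - b v))" for l v
  define x where "x l = lift (c l)" for l
  have Fb: "arc_eval b (F i) = 0" if "i < m" for i using J(1,2) that by blast
  have cb: "same_jet (c l) b" for l
    using b(2) by (auto simp: same_jet_iff c_def)
  have nd: "nondegenerate (c l)" for l
    using nondegenerate_cong[OF b(1) same_jet_sym[OF cb]] .
  have li: "liftable (c l)" for l
    using liftable_if_arc[OF nd cb Fb] .
  have x: "arc_eval (x l) (F i) = 0" if "i < m" for l i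
    unfolding x_def using nd li that by (rule arc_eval_lift)
  have xb: "same_jet (x l) b" for l
    unfolding x_def using same_jet_trans[OF lift_same_jet[OF nd li] cb] .
  have ndx: "nondegenerate (x l)" for l
    using nondegenerate_cong[OF b(1) same_jet_sym[OF xb]] .
  have x0: "x 0 = b"
    using Fb x lift_outside[OF nd li]
    by (intro arc_unique[OF ndx] xb) (auto simp: x_def c_def)
  have x1: "x 1 = a"
    using Fa x lift_outside[OF nd li] same_jet_trans[OF xb same_jet_sym[OF b(2)]]
    by (intro arc_unique[OF ndx]) (auto simp: x_def c_def)
  interpret function_ring "{g :: 'a \<Rightarrow> 'a. \<exists>q. \<forall>x. g x = poly q x}"
    by (rule function_ring_poly)
  have line: "family fps_const"
  proof -
    have "\<exists>q. \<forall>x::'a. fps_nth (fps_const x) j = poly q x" for j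
      by (intro exI[of _ "if j = 0 then [:0, 1:] else 0"]) simp
    then show ?thesis by (simp add: family_def)
  qed
  have "family (\<lambda>l. c l v)" for v
    unfolding c_def by (cases "v \<in> C") (auto intro!: family_const family_add family_mult line)
  \<comment> \<open>This coefficient of \<open>G\<close> depends on the common jet only, so dividing
    by it keeps the dependence on \<open>l\<close> polynomial.\<close>
  moreover have "fps_nth (arc_eval (c l) G) e' = fps_nth (arc_eval b G) e'" for l
    using arc_eval_cong_dvd[of "fps_X ^ (e + 1)" "c l" b G] cb[of l] e'_le
    by (auto simp: same_jet_def fps_X_power_dvd_iff simp del: power_Suc)
  ultimately have fam: "family (\<lambda>l. arc_eval (x l) g)" for g
    unfolding x_def using const
    by (intro family_arc_eval family_lift[OF arc_lifting_axioms]) simp_all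
  define P where "P = {g. \<forall>l. arc_eval (x l) g = 0}"
  have "is_prime_ideal P"
  proof -
    have "g1 \<in> P \<or> g2 \<in> P" if "g1 * g2 \<in> P" for g1 g2
    proof (rule ccontr)
      assume "\<not> (g1 \<in> P \<or> g2 \<in> P)"
      then obtain l1 l2 where "arc_eval (x l1) g1 \<noteq> 0" "arc_eval (x l2) g2 \<noteq> 0"
        by (auto simp: P_def)
      then obtain j1 j2 where j: "fps_nth (arc_eval (x l1) g1) j1 \<noteq> 0" "fps_nth (arc_eval (x l2) g2) j2 \<noteq> 0"
        by (auto simp: fps_eq_iff)
      obtain q1 q2 where q: "\<And>l. fps_nth (arc_eval (x l) g1) j1 = poly q1 l"
        "\<And>l. fps_nth (arc_eval (x l) g2) j2 = poly q2 l"
        using fam[of g1] fam[of g2] unfolding family_def by blast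
      \<comment> \<open>A nonzero product of two polynomials has finitely many roots, so in the
        infinite field some common \<open>l\<close> makes both coefficients nonzero.\<close>
      have "q1 * q2 \<noteq> 0" using j q by auto
      then have "finite {l. poly (q1 * q2) l = 0}" by (rule poly_roots_finite)
      then obtain l where "poly (q1 * q2) l \<noteq> 0"
        using infinite_UNIV_char_0[where 'a = 'a] by (metis (mono_tags) UNIV_eq_I mem_Collect_eq)
      then have "fps_nth (arc_eval (x l) g1) j1 \<noteq> 0" "fps_nth (arc_eval (x l) g2) j2 \<noteq> 0"
        by (auto simp: q)
      then have "arc_eval (x l) g1 \<noteq> 0" "arc_eval (x l) g2 \<noteq> 0" by auto
      then show False using that by (auto simp: P_def arc.hom_mult)
    qed
    then show ?thesis
      unfolding is_prime_ideal_def is_ideal_iff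
      by (auto simp: P_def arc.hom_add arc.hom_mult arc.hom_zero arc.hom_one)
  qed
  moreover have "P \<subseteq> {g. arc_eval b g = 0}"
  proof
    fix g assume "g \<in> P"
    then have "arc_eval (x 0) g = 0" by (simp add: P_def)
    then show "g \<in> {g. arc_eval b g = 0}" by (simp add: x0)
  qed
  moreover have "J \<subseteq> {g. arc_eval b g = 0}" using J(1) by blast
  moreover have "G \<notin> {g. arc_eval b g = 0}" using G_factor(3)[OF b(1)] by simp
  moreover have "F i \<in> P" if "i < m" for i using x[OF that] by (simp add: P_def)
  ultimately have "J \<subseteq> P"
    using ideal_subset_smaller_prime[OF _ is_prime_ideal_arc_kernel] J(2,3) d by blast
  then have "arc_eval (x 1) h = 0" using h by (auto simp: P_def)
  then show ?thesis by (simp add: x1)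
qed

section \<open>The adjugate of a Jacobian matrix\<close>

text \<open>Laplace expansion along column \<open>k\<close>, whose cofactors do not involve that
  column.\<close>

lemma adj_mat_replace_col:
  fixes M :: "'a::comm_ring_1 mat"
  assumes M: "M \<in> carrier_mat m m" and b: "b \<in> carrier_vec m" and k: "k < m"
  shows "(\<Sum>i<m. adj_mat M $$ (k, i) * b $ i) = det (replace_col M b k)"
proof -
  have Mb: "replace_col M b k \<in> carrier_mat m m" using M by (auto simp: replace_col_def)
  show ?thesis using b k M
    by (subst laplace_expansion_column[OF Mb k])
      (auto intro!: sum.cong arg_cong[of _ _ det] arg_cong[of _ _ "\<lambda>x. _ * x"] eq_matI
        simp: replace_col_def adj_mat_def cofactor_def mat_delete_def ac_simps)
qed

definition jacobian_mat ::
  "nat \<Rightarrow> (nat \<Rightarrow> ('n, 'a::comm_ring_1) mpoly) \<Rightarrow> (nat \<Rightarrow> 'n) \<Rightarrow> ('n, 'a) mpoly mat" where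
  "jacobian_mat m F c = mat m m (\<lambda>(i, j). mpoly_pderiv (c j) (F i))"

lemma exists_jacobian_minor:
  fixes F :: "nat \<Rightarrow> ('n::finite, 'a::field_char_0) mpoly"
  assumes c: "inj_on c {..<m}"
  obtains A where "jacobian_minor F m (c ` {..<m}) A (det (jacobian_mat m F c))"
    and "\<And>k w. k < m \<Longrightarrow>
      (\<Sum>i<m. A (c k) i * mpoly_pderiv w (F i)) = det (jacobian_mat m F (c(k := w)))"
proof -
  let ?M = "jacobian_mat m F c" and ?C = "c ` {..<m}"
  define A where "A v i = adj_mat ?M $$ (the_inv_into {..<m} c v, i)" for v i
  have M: "?M \<in> carrier_mat m m" by (simp add: jacobian_mat_def)
  note adj = adj_mat[OF M]
  have A: "A (c k) i = adj_mat ?M $$ (k, i)" if "k < m" for k i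
    using that by (simp add: A_def the_inv_into_f_f[OF c])
  have left: "(\<Sum>i<m. A (c k) i * mpoly_pderiv (c l) (F i)) = (if k = l then det ?M else 0)"
    if "k < m" "l < m" for k l
  proof -
    have "(adj_mat ?M * ?M) $$ (k, l) = (\<Sum>i<m. A (c k) i * mpoly_pderiv (c l) (F i))"
      using that M adj(1) by (auto simp: scalar_prod_def A jacobian_mat_def lessThan_atLeast0 intro!: sum.cong)
    then show ?thesis using that unfolding adj(3) by auto
  qed
  have right: "(\<Sum>k<m. A (c k) i * mpoly_pderiv (c k) (F j)) = (if i = j then det ?M else 0)"
    if "i < m" "j < m" for i j
  proof -
    have "(?M * adj_mat ?M) $$ (j, i) = (\<Sum>k<m. A (c k) i * mpoly_pderiv (c k) (F j))"
      using that M adj(1)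
      by (auto simp: scalar_prod_def A jacobian_mat_def lessThan_atLeast0 mult.commute intro!: sum.cong)
    then show ?thesis using that unfolding adj(2) by auto
  qed
  have "jacobian_minor F m ?C A (det ?M)"
  proof
    show "card ?C = m" using card_image[OF c] by simp
    show "(\<Sum>i<m. A v i * mpoly_pderiv w (F i)) = (if v = w then det ?M else 0)"
      if "v \<in> ?C" "w \<in> ?C" for v w
      using that left c by (auto simp: inj_on_def)
    show "(\<Sum>v\<in>?C. A v i * mpoly_pderiv v (F j)) = (if i = j then det ?M else 0)"
      if "i < m" "j < m" for i j
      using right[OF that] by (subst sum.reindex[OF c]) simp
  qed
  moreover have "(\<Sum>i<m. A (c k) i * mpoly_pderiv w (F i)) = det (jacobian_mat m F (c(k := w)))"
    if "k < m" for k w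
  proof -
    have "replace_col ?M (vec m (\<lambda>i. mpoly_pderiv w (F i))) k = jacobian_mat m F (c(k := w))"
      by (intro eq_matI) (auto simp: replace_col_def jacobian_mat_def)
    then show ?thesis
      using adj_mat_replace_col[OF M _ that, of "vec m (\<lambda>i. mpoly_pderiv w (F i))"] A[OF that] by simp
  qed
  ultimately show thesis using that by blast
qed

section \<open>The trivialization over a stratum\<close>

lemma function_ring_point_eval:
  fixes cs :: "'p \<Rightarrow> 'x \<Rightarrow> 'a::field_char_0"
  shows "function_ring {g. \<exists>T. \<forall>p\<in>D. g p = mpoly_eval id (cs p) T}" (is "function_ring ?R")
proof
  show "(\<lambda>_. c) \<in> ?R" for c by (auto intro: exI[of _ "Const c"])
  fix g h assume "g \<in> ?R" "h \<in> ?R"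
  then obtain S T where "\<forall>p\<in>D. g p = mpoly_eval id (cs p) S" "\<forall>p\<in>D. h p = mpoly_eval id (cs p) T"
    by auto
  then have "\<forall>p\<in>D. g p + h p = mpoly_eval id (cs p) (S + T)"
    "\<forall>p\<in>D. g p * h p = mpoly_eval id (cs p) (S * T)"
    by (simp_all add: point.hom_add point.hom_mult)
  then show "(\<lambda>p. g p + h p) \<in> ?R" "(\<lambda>p. g p * h p) \<in> ?R" by blast+
qed

text \<open>The functions that are polynomial divided by a power of \<open>H\<close> where \<open>H\<close> does not vanish.\<close>

lemma function_ring_localized:
  fixes H :: "('x, 'a::field_char_0) mpoly"
  shows "function_ring {g. \<exists>T k. \<forall>s. mpoly_eval id s H ^ k * g s = mpoly_eval id s T \<or> mpoly_eval id s H = 0}"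
    (is "function_ring ?R")
proof
  let ?H = "\<lambda>s. mpoly_eval id s H"
  show "(\<lambda>_. c) \<in> ?R" for c by (intro CollectI exI[of _ "Const c"] exI[of _ 0]) simp
  fix g h assume "g \<in> ?R" "h \<in> ?R"
  then obtain S T k l where g: "\<And>s. ?H s ^ k * g s = mpoly_eval id s S \<or> ?H s = 0"
    and h: "\<And>s. ?H s ^ l * h s = mpoly_eval id s T \<or> ?H s = 0"
    by auto
  have "?H s ^ (k + l) * (g s + h s) = ?H s ^ l * (?H s ^ k * g s) + ?H s ^ k * (?H s ^ l * h s)"
    for s by (simp add: power_add algebra_simps)
  then have "?H s ^ (k + l) * (g s + h s) = mpoly_eval id s (H ^ l * S + H ^ k * T) \<or> ?H s = 0" for s
    using g[of s] h[of s] by (metis point.hom_add point.hom_mult point.hom_power)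
  moreover have "?H s ^ (k + l) * (g s * h s) = (?H s ^ k * g s) * (?H s ^ l * h s)" for s
    by (simp add: power_add mult_ac)
  then have "?H s ^ (k + l) * (g s * h s) = mpoly_eval id s (S * T) \<or> ?H s = 0" for s
    using g[of s] h[of s] by (metis point.hom_mult)
  ultimately show "(\<lambda>p. g p + h p) \<in> ?R" "(\<lambda>p. g p * h p) \<in> ?R" by blast+
qed

definition jet_arc :: "(nat \<times> 'n \<Rightarrow> 'a) \<Rightarrow> 'n \<Rightarrow> 'a::zero fps" where
  "jet_arc s v = Abs_fps (\<lambda>i. s (i, v))"

lemma jet_map_in_jet_space: "jet_map e a \<in> jet_space e"
  by (simp add: jet_map_def jet_space_def)

locale stratum = arc_lifting F m C A G e e'
  for F :: "nat \<Rightarrow> ('n::finite, 'a::field_char_0) mpoly" and m C A G e e' +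
  fixes f :: "nat \<Rightarrow> ('n, 'a) mpoly" and N d :: nat
  assumes F_in: "\<And>i. i < m \<Longrightarrow> F i \<in> f ` {..<N}"
    and pure: "pure_dim (ideal_gen (f ` {..<N})) d" and d: "d + m = CARD('n)"
begin

definition S :: "(nat \<times> 'n \<Rightarrow> 'a) set" where
  "S = jet_map e ` {a \<in> arc_space N f. nondegenerate a}"

lemma jet_map_eq_iff: "jet_map e a = jet_map e b \<longleftrightarrow> same_jet a b"
proof
  assume eq: "jet_map e a = jet_map e b"
  have "fps_nth (a v) i = fps_nth (b v) i" if "i \<le> e" for v i
    using fun_cong[OF eq, of "(i, v)"] that by (simp add: jet_map_def arc_coeffs_def)
  then show "same_jet a b" by (simp add: same_jet_iff)
qed (auto simp: jet_map_def arc_coeffs_def same_jet_iff fun_eq_iff)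

lemma jet_map_jet_arc: "s \<in> jet_space e \<Longrightarrow> jet_map e (jet_arc s) = s"
  by (auto simp: jet_map_def jet_space_def jet_arc_def arc_coeffs_def fun_eq_iff not_le)

lemma arc_space_F: "a \<in> arc_space N f \<Longrightarrow> i < m \<Longrightarrow> arc_eval a (F i) = 0"
  using F_in[of i] by (auto simp: arc_space_def)

lemma arc_space_same_jet:
  assumes "b \<in> arc_space N f" "nondegenerate b" "same_jet a b" "\<And>i. i < m \<Longrightarrow> arc_eval a (F i) = 0"
  shows "a \<in> arc_space N f"
proof -
  have "ideal_gen (f ` {..<N}) \<subseteq> {h. arc_eval b h = 0}"
    using assms(1) is_prime_idealD(1)[OF is_prime_ideal_arc_kernel[of b]]
    by (intro ideal_gen_least) (auto simp: arc_space_def)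
  then have J: "arc_eval b h = 0" if "h \<in> ideal_gen (f ` {..<N})" for h using that by blast
  have FJ: "F i \<in> ideal_gen (f ` {..<N})" if "i < m" for i
    using F_in[OF that] ideal_gen_superset[of "f ` {..<N}"] by blast
  have "arc_eval a h = 0" if "h \<in> ideal_gen (f ` {..<N})" for h
    by (rule vanish_on_same_jet[OF assms(4,2,3) J FJ pure d that])
  then show ?thesis using ideal_gen_superset[of "f ` {..<N}"] by (auto simp: arc_space_def)
qed

text \<open>Here \<open>a\<close> is any arc with jet in \<open>S\<close>, inside the variety or
  not. It will be the truncated arc of a jet, or that arc with prescribed higher coefficients
  outside \<open>C\<close>.\<close>

lemma lift_over_S:
  assumes "s \<in> S" "jet_map e a = s"
  shows "nondegenerate a" "liftable a" "lift a \<in> arc_space N f" "jet_map e (lift a) = s"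
proof -
  obtain b where b: "b \<in> arc_space N f" "nondegenerate b" "same_jet a b"
    using assms by (auto simp: S_def simp flip: jet_map_eq_iff)
  show nd: "nondegenerate a" using nondegenerate_cong[OF b(2) same_jet_sym[OF b(3)]] .
  show li: "liftable a" using liftable_if_arc[OF nd b(3) arc_space_F[OF b(1)]] .
  show "lift a \<in> arc_space N f"
    by (rule arc_space_same_jet[OF b(1,2) same_jet_trans[OF lift_same_jet[OF nd li] b(3)]
          arc_eval_lift[OF nd li]])
  show "jet_map e (lift a) = s"
    using lift_same_jet[OF nd li] assms(2) by (simp add: jet_map_eq_iff flip: assms(2))
qed

text \<open>Membership in the image of a set of arcs is tested on one canonical arc, the truncated
  one, and so becomes a condition on the coordinates of the jet.\<close>

lemma S_iff:
  assumes "s \<in> jet_space e"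
  shows "s \<in> S \<longleftrightarrow> nondegenerate (jet_arc s) \<and> liftable (jet_arc s) \<and> lift (jet_arc s) \<in> arc_space N f"
    (is "_ \<longleftrightarrow> ?R")
proof
  show ?R if "s \<in> S" using lift_over_S[OF that jet_map_jet_arc[OF assms]] by blast
  assume R: ?R
  then have sj: "same_jet (lift (jet_arc s)) (jet_arc s)" by (intro lift_same_jet) auto
  then have "nondegenerate (lift (jet_arc s))"
    using R nondegenerate_cong[OF _ same_jet_sym] by blast
  moreover have "s = jet_map e (lift (jet_arc s))"
    using sj jet_map_jet_arc[OF assms] by (simp flip: jet_map_eq_iff)
  ultimately show "s \<in> S" using R unfolding S_def by (intro image_eqI) auto
qed

section \<open>Polynomial equations of a stratum\<close>

lemma exists_jet_coeff_poly:
  fixes g :: "('n, 'a) mpoly"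
  shows
  "\<exists>T. \<forall>s. fps_nth (arc_eval (jet_arc s) g) i = mpoly_eval id s T"
proof -
  interpret function_ring "{h :: (nat \<times> 'n \<Rightarrow> 'a) \<Rightarrow> 'a. \<exists>T. \<forall>s\<in>UNIV. h s = mpoly_eval id s T}"
    by (rule function_ring_point_eval)
  have "\<exists>T. \<forall>s\<in>UNIV. s (i, v) = mpoly_eval id s T" for i and v :: 'n
    by (intro exI[of _ "mvar (i, v)"]) simp
  then have "family (\<lambda>s. jet_arc s v)" for v
    unfolding family_def jet_arc_def fps_nth_Abs_fps mem_Collect_eq ..
  then have "family (\<lambda>s. arc_eval (jet_arc s) g)" by (rule family_arc_eval)
  then show ?thesis unfolding family_def by blast
qed

definition jet_coeff :: "('n, 'a) mpoly \<Rightarrow> nat \<Rightarrow> (nat \<times> 'n, 'a) mpoly" where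
  "jet_coeff g i = (SOME T. \<forall>s. fps_nth (arc_eval (jet_arc s) g) i = mpoly_eval id s T)"

lemma jet_coeff: "fps_nth (arc_eval (jet_arc s) g) i = mpoly_eval id s (jet_coeff g i)"
  unfolding jet_coeff_def by (rule someI_ex[OF exists_jet_coeff_poly, THEN spec])

abbreviation "H \<equiv> jet_coeff G e'"

text \<open>The coefficients along the lift are polynomials divided by powers of \<open>H\<close>;
  where \<open>H\<close> is nonzero, the numerator has the same zeros.\<close>

lemma exists_lift_coeff_poly:
  fixes g :: "('n, 'a) mpoly"
  shows
  "\<exists>T. \<forall>s. mpoly_eval id s H \<noteq> 0 \<longrightarrow>
     (fps_nth (arc_eval (lift (jet_arc s)) g) i = 0 \<longleftrightarrow> mpoly_eval id s T = 0)"
proof -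
  let ?H = "\<lambda>s. mpoly_eval id s H"
  interpret function_ring "{g. \<exists>T k. \<forall>s. ?H s ^ k * g s = mpoly_eval id s T \<or> ?H s = 0}"
    by (rule function_ring_localized)
  have "\<exists>T k. \<forall>s. ?H s ^ k * s (i, v) = mpoly_eval id s T \<or> ?H s = 0" for i v
    by (intro exI[of _ "mvar (i, v)"] exI[of _ 0]) simp
  then have jet: "family (\<lambda>s. jet_arc s v)" for v
    unfolding family_def jet_arc_def fps_nth_Abs_fps mem_Collect_eq ..
  have "\<exists>T k. \<forall>s. ?H s ^ k * inverse (?H s) = mpoly_eval id s T \<or> ?H s = 0"
    by (intro exI[of _ 1] exI[of _ 1]) (auto simp: point.hom_one)
  then have "family (\<lambda>s. lift (jet_arc s) v)" for v
    using jet by (intro family_lift[OF arc_lifting_axioms]) (simp_all add: jet_coeff)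
  then have "family (\<lambda>s. arc_eval (lift (jet_arc s)) g)" by (rule family_arc_eval)
  then obtain T k where T: "\<And>s. ?H s ^ k * fps_nth (arc_eval (lift (jet_arc s)) g) i = mpoly_eval id s T \<or> ?H s = 0"
    unfolding family_def by blast
  have "?H s \<noteq> 0 \<longrightarrow>
      (fps_nth (arc_eval (lift (jet_arc s)) g) i = 0 \<longleftrightarrow> mpoly_eval id s T = 0)" for s
    using T[of s] by (metis mult_eq_0_iff power_not_zero)
  then show ?thesis by blast
qed

text \<open>Inside \<open>H \<noteq> 0\<close> the conditions for membership become polynomial
  equations. The family \<open>E\<close> is indexed by infinitely many coefficients, because every
  \<open>f j\<close> must vanish along the whole lift.\<close>

lemma zariski_locally_closed_S: "zariski_locally_closed e S"
proof -
  define lift_coeff where "lift_coeff g i = (SOME T. \<forall>s. mpoly_eval id s H \<noteq> 0 \<longrightarrow>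
     (fps_nth (arc_eval (lift (jet_arc s)) g) i = 0 \<longleftrightarrow> mpoly_eval id s T = 0))" for g i
  have lift_coeff: "fps_nth (arc_eval (lift (jet_arc s)) g) i = 0 \<longleftrightarrow> mpoly_eval id s (lift_coeff g i) = 0"
    if "mpoly_eval id s H \<noteq> 0" for s g i
    unfolding lift_coeff_def by (rule someI_ex[OF exists_lift_coeff_poly, THEN spec, THEN mp, OF that])
  define E where "E = {jet_coeff G i | i. i < e'}
    \<union> {jet_coeff (minor v w) i | v w i. v \<in> C \<and> i < e'}
    \<union> {jet_coeff (\<Sum>k<m. A v k * F k) i | v i. v \<in> C \<and> i < e + e' + 1}
    \<union> {lift_coeff (f j) i | i j. j < N}"
  let ?Z = "{s \<in> jet_space e. \<forall>g\<in>E. mpoly_eval id s g = 0}"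
  let ?Z' = "{s \<in> jet_space e. \<forall>g\<in>{H}. mpoly_eval id s g = 0}"
  have nd: "nondegenerate (jet_arc s) \<longleftrightarrow> mpoly_eval id s H \<noteq> 0 \<and>
     (\<forall>i<e'. mpoly_eval id s (jet_coeff G i) = 0) \<and>
     (\<forall>v\<in>C. \<forall>w. \<forall>i<e'. mpoly_eval id s (jet_coeff (minor v w) i) = 0)" for s
    by (auto simp: nondegenerate_def fps_X_power_dvd_iff jet_coeff)
  have "defect a (\<lambda>_. 0) v = arc_eval a (\<Sum>k<m. A v k * F k)" for a v
    by (simp add: defect_def arc.hom_sum arc.hom_mult)
  then have li: "liftable (jet_arc s) \<longleftrightarrow>
     (\<forall>v\<in>C. \<forall>i<e + e' + 1. mpoly_eval id s (jet_coeff (\<Sum>k<m. A v k * F k) i) = 0)" for s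
    by (simp add: liftable_def fps_X_power_dvd_iff jet_coeff del: power_Suc)
  have ar: "lift (jet_arc s) \<in> arc_space N f \<longleftrightarrow>
     (\<forall>j<N. \<forall>i. mpoly_eval id s (lift_coeff (f j) i) = 0)" if "mpoly_eval id s H \<noteq> 0" for s
    using lift_coeff[OF that] by (simp add: arc_space_def fps_eq_iff)
  have E: "(\<forall>g\<in>E. mpoly_eval id s g = 0) \<longleftrightarrow>
     (\<forall>i<e'. mpoly_eval id s (jet_coeff G i) = 0) \<and>
     (\<forall>v\<in>C. \<forall>w. \<forall>i<e'. mpoly_eval id s (jet_coeff (minor v w) i) = 0) \<and>
     (\<forall>v\<in>C. \<forall>i<e + e' + 1. mpoly_eval id s (jet_coeff (\<Sum>k<m. A v k * F k) i) = 0) \<and>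
     (\<forall>j<N. \<forall>i. mpoly_eval id s (lift_coeff (f j) i) = 0)" for s
    unfolding E_def by blast
  have "s \<in> S \<longleftrightarrow> s \<in> ?Z - ?Z'" for s
  proof (cases "s \<in> jet_space e")
    case True
    show ?thesis
      unfolding S_iff[OF True] nd li using True ar[of s] E[of s] by auto
  next
    case False
    then show ?thesis using jet_map_in_jet_space by (auto simp: S_def)
  qed
  then have "S = ?Z - ?Z'" by blast
  then show ?thesis unfolding zariski_locally_closed_def zariski_closed_def by blast
qed

text \<open>The map keeps the jet and the coefficients beyond \<open>e\<close> of the
  \<open>d\<close> coordinates outside \<open>C\<close>. Its inverse attaches such coefficients to
  the truncated arc and lifts the result.\<close>

lemma exists_trivialization:
  "\<exists>\<phi>. textile_invertible e d {a \<in> arc_space N f. jet_map e a \<in> S} S \<phi> \<and>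
     (\<forall>a\<in>arc_space N f. jet_map e a \<in> S \<longrightarrow> fst (\<phi> a) = jet_map e a)"
proof -
  let ?D = "{a \<in> arc_space N f. jet_map e a \<in> S}" and ?E = "S \<times> fibre_space e d"
  have "card (- C) = d" using card_C d by (simp add: Compl_eq_Diff_UNIV card_Diff_subset)
  then obtain h where h: "bij_betw h {..<d} (- C)"
    using finite_same_card_bij[of "{..<d}" "- C"] by auto
  define k where "k = the_inv_into {..<d} h"
  have hk: "h (k v) = v" "k v < d" if "v \<notin> C" for v
    using that h f_the_inv_into_f_bij_betw[OF h] bij_betw_apply[OF bij_betw_the_inv_into[OF h]]
    by (auto simp: k_def)
  have kh: "k (h j) = j" "h j \<notin> C" if "j < d" for j
    using that h bij_betw_apply[OF h] the_inv_into_f_f[OF bij_betw_imp_inj_on[OF h]]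
    by (auto simp: k_def)
  define \<phi> where "\<phi> a = (jet_map e a,
      \<lambda>j. if j < d then Abs_fps (\<lambda>i. if i \<le> e then 0 else fps_nth (a (h j)) i) else 0)"
    for a :: "'n \<Rightarrow> 'a fps"
  define base where "base p v = jet_arc (fst p) v + (if v \<in> C then 0 else snd p (k v))"
    for p :: "(nat \<times> 'n \<Rightarrow> 'a) \<times> (nat \<Rightarrow> 'a fps)" and v
  define \<psi> where "\<psi> p = lift (base p)" for p
  have fibre: "fps_nth (b j) i = 0" if "b \<in> fibre_space e d" "i \<le> e" for b :: "nat \<Rightarrow> 'a fps" and j i
    using that unfolding fibre_space_def
    by (cases "j < d") (auto simp: fps_X_power_dvd_iff simp del: power_Suc)
  have S_jet: "s (i, v) = 0" if "s \<in> S" "e < i" for s i v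
    using that by (auto simp: S_def jet_map_def)
  have base: "jet_map e (base p) = fst p" if "p \<in> ?E" for p
    using that S_jet fibre
    by (auto simp: jet_map_def base_def arc_coeffs_def jet_arc_def fun_eq_iff)
  have \<psi>: "\<psi> p \<in> ?D" "jet_map e (\<psi> p) = fst p" "\<And>v. v \<notin> C \<Longrightarrow> \<psi> p v = base p v"
    if "p \<in> ?E" for p
  proof -
    have "fst p \<in> S" using that by auto
    note * = lift_over_S[OF this base[OF that]]
    then show "\<psi> p \<in> ?D" "jet_map e (\<psi> p) = fst p" "\<And>v. v \<notin> C \<Longrightarrow> \<psi> p v = base p v"
      using \<open>fst p \<in> S\<close> lift_outside[OF *(1,2)] by (auto simp: \<psi>_def)
  qed
  have \<phi>\<psi>: "\<phi> (\<psi> p) = p" if p: "p \<in> ?E" for p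
  proof -
    have "snd (\<phi> (\<psi> p)) j = snd p j" for j
    proof (cases "j < d")
      case True
      show ?thesis
      proof (rule fps_ext)
        fix i
        show "fps_nth (snd (\<phi> (\<psi> p)) j) i = fps_nth (snd p j) i"
          using True p S_jet[of "fst p" i "h j"] fibre[of "snd p" i j] kh[OF True] \<psi>(3)[OF p, of "h j"]
          by (auto simp: \<phi>_def base_def jet_arc_def)
      qed
    next
      case False
      then show ?thesis using p by (auto simp: \<phi>_def fibre_space_def)
    qed
    then show ?thesis using \<psi>(2)[OF p] by (intro prod_eqI ext) (simp_all add: \<phi>_def)
  qed
  have \<phi>: "\<phi> a \<in> ?E" if "a \<in> ?D" for a
    using that by (auto simp: \<phi>_def fibre_space_def fps_X_power_dvd_iff simp del: power_Suc)
  have \<psi>\<phi>: "\<psi> (\<phi> a) = a" if a: "a \<in> ?D" for a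
  proof -
    have sj: "same_jet (\<psi> (\<phi> a)) a"
      using \<psi>(2)[OF \<phi>[OF a]] by (simp add: \<phi>_def flip: jet_map_eq_iff)
    show ?thesis
    proof (rule arc_unique[OF _ sj])
      show "nondegenerate (\<psi> (\<phi> a))"
        using lift_over_S(1)[OF _ \<psi>(2)[OF \<phi>[OF a]]] a by (simp add: \<phi>_def)
      show "arc_eval (\<psi> (\<phi> a)) (F i) = 0" "arc_eval a (F i) = 0" if "i < m" for i
        using that arc_space_F a \<psi>(1)[OF \<phi>[OF a]] by auto
      show "\<psi> (\<phi> a) v = a v" if "v \<notin> C" for v
        using \<psi>(3)[OF \<phi>[OF a] that] hk[OF that] that
        by (auto simp: \<phi>_def base_def jet_arc_def jet_map_def arc_coeffs_def intro!: fps_ext)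
    qed
  qed
  have bij: "bij_betw \<phi> ?D ?E"
  proof (rule bij_betw_byWitness[of _ \<psi>])
    show "\<phi> ` ?D \<subseteq> ?E" using \<phi> by blast
    show "\<psi> ` ?E \<subseteq> ?D" using \<psi>(1) by blast
  qed (use \<phi>\<psi> \<psi>\<phi> in blast)+
  have inv: "inv_into ?D \<phi> p = \<psi> p" if "p \<in> ?E" for p
    using bij_betw_imp_inj_on[OF bij] \<phi>\<psi>[OF that] \<psi>(1)[OF that] by (intro inv_into_f_eq)
  have "textile_on arc_coeffs product_coeffs ?D \<phi>"
    unfolding textile_on_def
  proof (intro exI ballI allI)
    fix a :: "'n \<Rightarrow> 'a fps" and y
    show "product_coeffs (\<phi> a) y = mpoly_eval id (arc_coeffs a) (case y of
        Inl (i, v) \<Rightarrow> (if i \<le> e then mvar (i, v) else 0)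
      | Inr (i, j) \<Rightarrow> (if j < d \<and> e < i then mvar (i, h j) else 0))"
      by (auto simp: product_coeffs_def \<phi>_def jet_map_def arc_coeffs_def point.hom_zero
          split: sum.splits)
  qed
  moreover have H: "mpoly_eval id s H \<noteq> 0" if "s \<in> S" for s
  proof -
    have "s \<in> jet_space e" using that jet_map_in_jet_space by (auto simp: S_def)
    then have "nondegenerate (jet_arc s)" using that S_iff by blast
    then show ?thesis by (simp add: nondegenerate_def jet_coeff)
  qed
  moreover have "textile_on (localized_coeffs H) arc_coeffs ?E (inv_into ?D \<phi>)"
  proof -
    let ?ev = "\<lambda>p. mpoly_eval id (localized_coeffs H p)"
    interpret function_ring "{g. \<exists>T. \<forall>p\<in>?E. g p = ?ev p T}"
      by (rule function_ring_point_eval)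
    have "\<exists>T. \<forall>p\<in>?E. fst p (i, v) = ?ev p T" for i v
      by (intro exI[of _ "mvar (Inl (Some (i, v)))"]) (auto simp: localized_coeffs_def)
    then have 1: "family (\<lambda>p. jet_arc (fst p) v)" for v
    unfolding family_def jet_arc_def fps_nth_Abs_fps mem_Collect_eq ..
    have "\<exists>T. \<forall>p\<in>?E. fps_nth (snd p j) i = ?ev p T" for i j
      by (intro exI[of _ "mvar (Inr (i, j))"]) (auto simp: localized_coeffs_def arc_coeffs_def)
    then have 2: "family (\<lambda>p. snd p j)" for j unfolding family_def mem_Collect_eq ..
    have fam_base: "family (\<lambda>p. base p v)" for v
      unfolding base_def
      by (cases "v \<in> C"; simp only: if_True if_False; intro family_add family_const 1 2)
    \<comment> \<open>The arc \<open>base p\<close> has the jet \<open>fst p\<close>, so the only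
      denominator is the value of \<open>H\<close> there; its inverse is the coordinate
      \<open>None\<close>.\<close>
    have "fps_nth (arc_eval (base p) G) e' = mpoly_eval id (fst p) H" if "p \<in> ?E" for p
    proof -
      have "fst p \<in> jet_space e" using that jet_map_in_jet_space by (auto simp: S_def)
      then have "same_jet (base p) (jet_arc (fst p))"
        unfolding jet_map_eq_iff[symmetric] base[OF that] by (simp only: jet_map_jet_arc)
      then show ?thesis
        using arc_eval_cong_dvd[of "fps_X ^ (e + 1)" "base p" "jet_arc (fst p)" G] e'_le
        by (auto simp: same_jet_def fps_X_power_dvd_iff jet_coeff simp del: power_Suc)
    qed
    then have "\<forall>p\<in>?E. inverse (fps_nth (arc_eval (base p) G) e') = ?ev p (mvar (Inl None))"
      by (auto simp: localized_coeffs_def)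
    then have "family (\<lambda>p. \<psi> p v)" for v
      unfolding \<psi>_def by (intro family_lift[OF arc_lifting_axioms] fam_base) blast
    then have coeff: "\<exists>T. \<forall>p\<in>?E. fps_nth (\<psi> p v) i = ?ev p T" for v i
      unfolding family_def mem_Collect_eq ..
    have "\<forall>y. \<exists>T. \<forall>p\<in>?E. arc_coeffs (\<psi> p) y = ?ev p T"
    proof
      fix y :: "nat \<times> 'n"
      obtain i v where y: "y = (i, v)" by (cases y)
      show "\<exists>T. \<forall>p\<in>?E. arc_coeffs (\<psi> p) y = ?ev p T"
        unfolding y arc_coeffs_def split_conv by (rule coeff)
    qed
    from choice[OF this] obtain T where "\<forall>y. \<forall>p\<in>?E. arc_coeffs (\<psi> p) y = ?ev p (T y)" ..
    then show ?thesis unfolding textile_on_def by (intro exI[of _ T] ballI allI) (simp only: inv)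
  qed
  ultimately have "textile_invertible e d ?D S \<phi>"
    unfolding textile_invertible_def using bij by blast
  then show ?thesis by (intro exI[of _ \<phi>]) (simp add: \<phi>_def)
qed

end

section \<open>The stratification\<close>

text \<open>Expresses \<open>nondegenerate\<close> through minors alone, without the adjugate, so
  that the strata can be indexed by rows, columns and order.\<close>

definition stratum_arcs ::
  "nat \<Rightarrow> nat \<Rightarrow> (nat \<Rightarrow> ('n::finite, 'a::comm_ring_1) mpoly) \<Rightarrow> (nat \<Rightarrow> nat) \<Rightarrow> (nat \<Rightarrow> 'n) \<Rightarrow> nat \<Rightarrow>
   ('n \<Rightarrow> 'a fps) set" where
  "stratum_arcs m N f r c e' = {a \<in> arc_space N f.
     (let M = \<lambda>c. arc_eval a (det (jacobian_mat m (\<lambda>i. f (r i)) c)) in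
        fps_X ^ e' dvd M c \<and> fps_nth (M c) e' \<noteq> 0 \<and>
        (\<forall>k<m. \<forall>w. w \<notin> c ` {..<m} \<longrightarrow> fps_X ^ e' dvd M (c(k := w))))}"

lemma stratum_trivialization:
  fixes f :: "nat \<Rightarrow> ('n::finite, 'a::field_char_0) mpoly"
  assumes pure: "pure_dim (ideal_gen (f ` {..<N})) d" and d: "d + m = CARD('n)" and e': "e' \<le> e"
    and r: "r ` {..<m} \<subseteq> {..<N}" and c: "inj_on c {..<m}"
    and S: "S = jet_map e ` stratum_arcs m N f r c e'"
  shows "zariski_locally_closed e S \<and>
      (\<exists>\<phi>. textile_invertible e d {a \<in> arc_space N f. jet_map e a \<in> S} S \<phi> \<and>
           (\<forall>a\<in>arc_space N f. jet_map e a \<in> S \<longrightarrow> fst (\<phi> a) = jet_map e a))"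
proof -
  let ?F = "\<lambda>i. f (r i)" and ?C = "c ` {..<m}"
  obtain A where A: "jacobian_minor ?F m ?C A (det (jacobian_mat m ?F c))"
    and minor: "\<And>k w. k < m \<Longrightarrow>
      (\<Sum>i<m. A (c k) i * mpoly_pderiv w (?F i)) = det (jacobian_mat m ?F (c(k := w)))"
    using exists_jacobian_minor[OF c, of ?F] by blast
  interpret jm: jacobian_minor ?F m ?C A "det (jacobian_mat m ?F c)" by (rule A)
  interpret st: stratum ?F m ?C A "det (jacobian_mat m ?F c)" e e' f N d
    using e' pure d r by unfold_locales auto
  have "st.nondegenerate a \<longleftrightarrow>
     (fps_X ^ e' dvd arc_eval a (det (jacobian_mat m ?F c)) \<and>
      fps_nth (arc_eval a (det (jacobian_mat m ?F c))) e' \<noteq> 0 \<and>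
      (\<forall>k<m. \<forall>w. w \<notin> ?C \<longrightarrow> fps_X ^ e' dvd arc_eval a (det (jacobian_mat m ?F (c(k := w))))))"
    (is "_ \<longleftrightarrow> ?G \<and> ?R") for a
  proof -
    \<comment> \<open>Exchanging with a column of \<open>?C\<close> gives \<open>G\<close> or
      \<open>0\<close>, so only \<open>w\<close> outside imposes a condition.\<close>
    have "fps_X ^ e' dvd arc_eval a (jm.minor (c k) w) \<longleftrightarrow>
        (w \<notin> ?C \<longrightarrow> fps_X ^ e' dvd arc_eval a (det (jacobian_mat m ?F (c(k := w)))))"
      if ?G "k < m" for k w
    proof (cases "w \<in> ?C")
      case True
      then have "jm.minor (c k) w = (if c k = w then det (jacobian_mat m ?F c) else 0)"
        unfolding jm.minor_def using that(2) by (intro jm.adj_left) auto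
      then show ?thesis using that(1) True by (simp add: arc.hom_zero)
    next
      case False
      then show ?thesis using minor[OF that(2)] by (simp add: jm.minor_def)
    qed
    then show ?thesis unfolding st.nondegenerate_def by auto
  qed
  then have "stratum_arcs m N f r c e' = {a \<in> arc_space N f. st.nondegenerate a}"
    by (simp add: stratum_arcs_def Let_def)
  then have "S = st.S" using S by (simp add: st.S_def)
  then show ?thesis using st.zariski_locally_closed_S st.exists_trivialization by simp
qed

section \<open>Minors and the order along the singular ideal\<close>

lemma jacobian_mat_cong:
  assumes "\<And>i. i < m \<Longrightarrow> F i = F' i" "\<And>j. j < m \<Longrightarrow> c j = c' j"
  shows "jacobian_mat m F c = jacobian_mat m F' c'"
  unfolding jacobian_mat_def using assms by (intro cong_mat) auto

lemma minors_of_jacobian_alt: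
  "minors_of_jacobian m N f = {det (jacobian_mat m (\<lambda>i. f (r i)) c) | r c.
     inj_on r {..<m} \<and> r ` {..<m} \<subseteq> {..<N} \<and> inj_on c {..<m}}"
  by (simp add: minors_of_jacobian_def jacobian_mat_def)

lemma fps_order_le: "fps_nth g i \<noteq> 0 \<Longrightarrow> fps_order g \<le> enat i"
  by (auto simp: fps_order_def intro: subdegree_leI)

lemma fps_order_ge:
  fixes g :: "'a::comm_ring_1 fps"
  shows "fps_X ^ k dvd g \<Longrightarrow> enat k \<le> fps_order g"
  by (auto simp: fps_order_def fps_X_power_dvd_iff intro: subdegree_geI)

text \<open>The polynomials of order above \<open>e\<close> along \<open>a\<close> form an ideal
  containing all \<open>f i\<close>, which vanish along \<open>a\<close>. If it contained all minors
  as well, it would contain the whole singular ideal.\<close>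

lemma arcs_order_le_minor:
  assumes a: "a \<in> arcs_order_le d N f e"
  obtains r c i where "i \<le> e" "inj_on r {..<CARD('n) - d}" "r ` {..<CARD('n) - d} \<subseteq> {..<N}"
    "inj_on c {..<CARD('n) - d}"
    "fps_nth (arc_eval a (det (jacobian_mat (CARD('n) - d) (\<lambda>i. f (r i)) (c :: nat \<Rightarrow> 'n::finite)))) i \<noteq> 0"
proof -
  let ?m = "CARD('n) - d" and ?I = "{g. fps_X ^ (e + 1) dvd arc_eval a g}"
  have "\<not> minors_of_jacobian ?m N f \<subseteq> ?I"
  proof
    assume "minors_of_jacobian ?m N f \<subseteq> ?I"
    moreover have "f ` {..<N} \<subseteq> ?I" using a by (auto simp: arcs_order_le_def arc_space_def)
    moreover have "is_ideal ?I" by (auto simp: is_ideal_iff arc.hom_add arc.hom_mult arc.hom_zero)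
    ultimately have "sing_ideal d N f \<subseteq> ?I" unfolding sing_ideal_def by (intro ideal_gen_least) auto
    then have "enat (e + 1) \<le> order_along (sing_ideal d N f) a"
      unfolding order_along_def by (intro INF_greatest fps_order_ge) auto
    then have "enat (e + 1) \<le> enat e"
      using a by (auto simp: arcs_order_le_def dest: order_trans)
    then show False by simp
  qed
  then obtain g where g: "g \<in> minors_of_jacobian ?m N f" "\<not> fps_X ^ (e + 1) dvd arc_eval a g" by blast
  then obtain i where "i \<le> e" "fps_nth (arc_eval a g) i \<noteq> 0"
    by (auto simp: fps_X_power_dvd_iff less_Suc_eq_le simp del: power_Suc)
  moreover obtain r c where "g = det (jacobian_mat ?m (\<lambda>i. f (r i)) c)" "inj_on r {..<?m}"
    "r ` {..<?m} \<subseteq> {..<N}" "inj_on c {..<?m}"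
    using g(1) unfolding minors_of_jacobian_alt by (elim CollectE exE conjE)
  ultimately show thesis using that[of i r c] by simp
qed

lemma arcs_order_leI:
  fixes c :: "nat \<Rightarrow> 'n::finite"
  assumes "a \<in> arc_space N f" "inj_on r {..<CARD('n) - d}" "r ` {..<CARD('n) - d} \<subseteq> {..<N}"
    "inj_on c {..<CARD('n) - d}" "i \<le> e"
    "fps_nth (arc_eval a (det (jacobian_mat (CARD('n) - d) (\<lambda>i. f (r i)) c))) i \<noteq> 0"
  shows "a \<in> arcs_order_le d N f e"
proof -
  let ?g = "det (jacobian_mat (CARD('n) - d) (\<lambda>i. f (r i)) c)"
  have "?g \<in> sing_ideal d N f"
  proof -
    have "?g \<in> minors_of_jacobian (CARD('n) - d) N f"
      
      unfolding minors_of_jacobian_alt using assms(2-4)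
      by (intro CollectI exI[of _ r] exI[of _ c] conjI) (rule refl)
    then show ?thesis
      unfolding sing_ideal_def using ideal_gen_superset[THEN subsetD, OF UnI2] by blast
  qed
  then have "order_along (sing_ideal d N f) a \<le> fps_order (arc_eval a ?g)"
    unfolding order_along_def by (rule INF_lower)
  also have "\<dots> \<le> enat i" using assms(6) by (rule fps_order_le)
  also have "\<dots> \<le> enat e" using assms(5) by simp
  finally show ?thesis using assms(1) by (simp add: arcs_order_le_def)
qed

text \<open>A minor is chosen whose order along the arc is minimal among all of them.\<close>

lemma arcs_order_le_stratum:
  fixes f :: "nat \<Rightarrow> ('n::finite, 'a::comm_ring_1) mpoly"
  assumes a: "a \<in> arcs_order_le d N f e" and m: "m = CARD('n) - d"
  obtains r c e' where "e' \<le> e" "r \<in> {..<m} \<rightarrow>\<^sub>E {..<N}" "c \<in> {..<m} \<rightarrow>\<^sub>E UNIV"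
    "inj_on r {..<m}" "inj_on c {..<m}" "a \<in> stratum_arcs m N f r c e'"
proof -
  let ?M = "\<lambda>r c. arc_eval a (det (jacobian_mat m (\<lambda>i. f (r i)) c))"
  define ok where "ok i \<longleftrightarrow> (\<exists>r c. inj_on r {..<m} \<and> r ` {..<m} \<subseteq> {..<N} \<and> inj_on c {..<m} \<and>
      fps_nth (?M r c) i \<noteq> 0)" for i
  obtain i where i: "i \<le> e" "ok i"
    using arcs_order_le_minor[OF a] unfolding ok_def m by metis
  \<comment> \<open>The least index at which some minor has a nonzero coefficient; below it all
    coefficients of all minors vanish.\<close>
  define e' where "e' = (LEAST i. ok i)"
  have "ok e'" "e' \<le> i" unfolding e'_def using i(2) by (auto intro: LeastI Least_le)
  then obtain r c where rc: "inj_on r {..<m}" "r ` {..<m} \<subseteq> {..<N}" "inj_on c {..<m}"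
    "fps_nth (?M r c) e' \<noteq> 0"
    unfolding ok_def by blast
  have dvd: "fps_X ^ e' dvd ?M r c'" if "inj_on c' {..<m}" for c'
    unfolding fps_X_power_dvd_iff
  proof (intro allI impI)
    fix j assume "j < e'"
    then have "\<not> ok j" unfolding e'_def by (rule not_less_Least)
    then show "fps_nth (?M r c') j = 0" using rc that unfolding ok_def by blast
  qed
  let ?r = "restrict r {..<m}" and ?c = "restrict c {..<m}"
  have eq: "?M ?r c1 = ?M r c2" if "\<And>j. j < m \<Longrightarrow> c1 j = c2 j" for c1 c2
    using that by (intro arg_cong[of _ _ "\<lambda>M. arc_eval a (det M)"] jacobian_mat_cong) auto
  \<comment> \<open>The exchanged listing is injective, hence gives a genuine minor, to which
    minimality applies.\<close>
  have "inj_on (?c(k := w)) {..<m}" if "k < m" "w \<notin> ?c ` {..<m}" for k w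
    using rc(3) that by (auto simp: inj_on_def)
  then have upd: "fps_X ^ e' dvd ?M ?r (?c(k := w))" if "k < m" "w \<notin> ?c ` {..<m}" for k w
    using dvd[of "?c(k := w)"] eq[of "?c(k := w)" "?c(k := w)"] that by simp
  have M: "?M ?r ?c = ?M r c" by (rule eq) simp
  have "a \<in> stratum_arcs m N f ?r ?c e'"
    unfolding stratum_arcs_def Let_def
  proof (intro CollectI conjI allI impI)
    show "a \<in> arc_space N f" using a by (simp add: arcs_order_le_def)
    show "fps_X ^ e' dvd ?M ?r ?c" unfolding M using rc(3) by (rule dvd)
    show "fps_nth (?M ?r ?c) e' \<noteq> 0" unfolding M by (rule rc(4))
  qed (rule upd)
  moreover have "?r \<in> {..<m} \<rightarrow>\<^sub>E {..<N}" "?c \<in> {..<m} \<rightarrow>\<^sub>E UNIV" using rc(2) by auto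
  moreover have "inj_on ?r {..<m}" "inj_on ?c {..<m}" using rc(1,3) by (auto simp: inj_on_def)
  ultimately show thesis using that[of e' ?r ?c] \<open>e' \<le> i\<close> i(1) by simp
qed

theorem theorem5p1:
  fixes f :: "nat \<Rightarrow> ('n::finite, 'a::field_char_0) mpoly" and N d e :: nat
  assumes "pure_dim (ideal_gen (f ` {..<N})) d"
  shows "\<exists>\<C>. finite \<C> \<and> \<Union>\<C> = jet_map e ` arcs_order_le d N f e \<and>
    (\<forall>S\<in>\<C>. zariski_locally_closed e S \<and>
      (\<exists>\<phi>. textile_invertible e d {a \<in> arc_space N f. jet_map e a \<in> S} S \<phi> \<and>
           (\<forall>a\<in>arc_space N f. jet_map e a \<in> S \<longrightarrow> fst (\<phi> a) = jet_map e a)))"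
proof (cases "arc_space N f = {}")
  \<comment> \<open>Without arcs the ideal may be the unit ideal, which has every pure dimension
    vacuously, so \<open>d \<le> CARD('n)\<close> can fail; the empty cover serves.\<close>
  case True
  then have "arcs_order_le d N f e = {}" by (auto simp: arcs_order_le_def)
  then show ?thesis by (intro exI[of _ "{}"]) simp
next
  case False
  then obtain a where a: "a \<in> arc_space N f" by blast
  have "ideal_gen (f ` {..<N}) \<subseteq> {h. arc_eval a h = 0}"
    using a is_prime_idealD(1)[OF is_prime_ideal_arc_kernel[of a]]
    by (intro ideal_gen_least) (auto simp: arc_space_def)
  then have "d \<le> CARD('n)"
    by (rule pure_dim_le_card[OF assms is_prime_ideal_arc_kernel])
  define m where "m = CARD('n) - d"
  then have dm: "d + m = CARD('n)" using \<open>d \<le> CARD('n)\<close> by simp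
  \<comment> \<open>Extensional listings of rows and columns make the index set finite.\<close>
  define K where "K = {(r, c, e'). r \<in> {..<m} \<rightarrow>\<^sub>E {..<N} \<and> c \<in> {..<m} \<rightarrow>\<^sub>E (UNIV :: 'n set) \<and>
     inj_on r {..<m} \<and> inj_on c {..<m} \<and> e' \<le> e}"
  define \<C> where "\<C> = (\<lambda>(r, c, e'). jet_map e ` stratum_arcs m N f r c e') ` K"
  have "K \<subseteq> ({..<m} \<rightarrow>\<^sub>E {..<N}) \<times> ({..<m} \<rightarrow>\<^sub>E UNIV) \<times> {..e}" by (auto simp: K_def)
  then have "finite K" by (rule finite_subset) (intro finite_cartesian_product finite_PiE; simp)
  then have fin: "finite \<C>" by (simp add: \<C>_def)
  have union: "\<Union>\<C> = jet_map e ` arcs_order_le d N f e"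
  proof
    show "\<Union>\<C> \<subseteq> jet_map e ` arcs_order_le d N f e"
    proof -
      have "b \<in> arcs_order_le d N f e" if "(r, c, e') \<in> K" "b \<in> stratum_arcs m N f r c e'" for r c e' b
        using that unfolding K_def stratum_arcs_def Let_def m_def
        by (intro arcs_order_leI[of b N f r d c e' e]) auto
      then show ?thesis unfolding \<C>_def by blast
    qed
    show "jet_map e ` arcs_order_le d N f e \<subseteq> \<Union>\<C>"
    proof clarify
      fix b assume "b \<in> arcs_order_le d N f e"
      then obtain r c e' where "(r, c, e') \<in> K" "b \<in> stratum_arcs m N f r c e'"
        using m_def unfolding K_def by (rule arcs_order_le_stratum) blast
      then show "jet_map e b \<in> \<Union>\<C>" unfolding \<C>_def by blast
    qed
  qed
  have strata: "zariski_locally_closed e S \<and>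
      (\<exists>\<phi>. textile_invertible e d {a \<in> arc_space N f. jet_map e a \<in> S} S \<phi> \<and>
           (\<forall>a\<in>arc_space N f. jet_map e a \<in> S \<longrightarrow> fst (\<phi> a) = jet_map e a))" if "S \<in> \<C>" for S
  proof -
    obtain t where "t \<in> K" "S = (\<lambda>(r, c, e'). jet_map e ` stratum_arcs m N f r c e') t"
      using \<open>S \<in> \<C>\<close> unfolding \<C>_def by blast
    moreover obtain r c e' where "t = (r, c, e')" by (cases t)
    ultimately have "(r, c, e') \<in> K" and S: "S = jet_map e ` stratum_arcs m N f r c e'" by simp_all
    then have "e' \<le> e" "r ` {..<m} \<subseteq> {..<N}" "inj_on c {..<m}" by (auto simp: K_def)
    from stratum_trivialization[OF assms dm this S] show ?thesis .
  qed
  show ?thesis by (rule exI[of _ \<C>], rule conjI[OF fin conjI[OF union ballI[OF strata]]])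
qed

end
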